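(* Let $\delta>0$, let $\mathcal{X}$ be a non-empty $\delta$-well spaced subset of $\mathbb{R}/\mathbb{Z}$ and let $N\ge 1000$ be a real number. Let $(u_p)_{p\le N}$ be a sequence of complex numbers indexed by the primes $p\le N$. Then $$\sum_{x\in\mathcal{X}}\Bigl|\sum_{p\le N}u_p e(xp)\Bigr|^2\le 280\,\frac{N+\delta^{-1}}{\log N}\,\log(2|\mathcal{X}|)\sum_{p\le N}|u_p|^2.$$
   Context: The variable $p$ always denotes a prime number, and sums over $p\le N$ run over primes. We write $e(\alpha)=\exp(2i\pi\alpha)$, and $|y|_{\mathbb{Z}}=\min_{k\in\mathbb{Z}}|y-k|$ for the distance of $y$ to the nearest integer. A set $\mathcal{X}\subset\mathbb{R}/\mathbb{Z}$ is called $\delta$-well spaced when $|x-x'|_{\mathbb{Z}}\ge\delta$ for all distinct $x,x'\in\mathcal{X}$ (such a set is finite); $|\mathcal{X}|$ is its cardinality. *)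

theory Defs
  imports Complex_Main "HOL-Computational_Algebra.Primes"
begin

quotient_type circle = real / "\<lambda>x y :: real. x - y \<in> \<int>"
proof (rule equivpI)
  show "reflp (\<lambda>x y :: real. x - y \<in> \<int>)"
    by (simp add: reflp_def)
  show "symp (\<lambda>x y :: real. x - y \<in> \<int>)"
    by (metis (no_types, lifting) Ints_minus minus_diff_eq sympI)
  show "transp (\<lambda>x y :: real. x - y \<in> \<int>)"
    by (rule transpI) (metis Ints_add diff_add_cancel add_diff_eq)
qed

instantiation circle :: ab_group_add
begin

lift_definition zero_circle :: circle is "0 :: real" .

lift_definition plus_circle :: "circle \<Rightarrow> circle \<Rightarrow> circle" is "(+) :: real \<Rightarrow> real \<Rightarrow> real"
  by (metis Ints_add add_diff_add)

lift_definition uminus_circle :: "circle \<Rightarrow> circle" is "uminus :: real \<Rightarrow> real"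
  by (metis Ints_minus minus_diff_minus)

lift_definition minus_circle :: "circle \<Rightarrow> circle \<Rightarrow> circle" is "(-) :: real \<Rightarrow> real \<Rightarrow> real"
  by (metis (no_types, opaque_lifting) Ints_diff diff_diff_eq2 diff_add_eq add.commute diff_diff_eq)

instance
  by standard (transfer; simp)+

end

lift_definition nat_scale :: "nat \<Rightarrow> circle \<Rightarrow> circle" is "\<lambda>n x. real n * x"
  by (metis Ints_mult Ints_of_nat right_diff_distrib)

text \<open>The infimum over the integers \<open>k\<close> is attained, so it is the minimum.\<close>

definition dist_int :: "real \<Rightarrow> real" where
  "dist_int y = (INF k :: int. \<bar>y - of_int k\<bar>)"

lemma dist_int_add_of_int: "dist_int (y + of_int m) = dist_int y"
proof -
  have "range (\<lambda>k :: int. \<bar>y + of_int m - of_int k\<bar>) = range (\<lambda>k :: int. \<bar>y - of_int k\<bar>)"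
  proof (intro equalityI subsetI)
    fix z assume "z \<in> range (\<lambda>k :: int. \<bar>y + of_int m - of_int k\<bar>)"
    then obtain k :: int where "z = \<bar>y + of_int m - of_int k\<bar>" by blast
    then have "z = \<bar>y - of_int (k - m)\<bar>" by (simp add: algebra_simps)
    then show "z \<in> range (\<lambda>k :: int. \<bar>y - of_int k\<bar>)" by blast
  next
    fix z assume "z \<in> range (\<lambda>k :: int. \<bar>y - of_int k\<bar>)"
    then obtain k :: int where "z = \<bar>y - of_int k\<bar>" by blast
    then have "z = \<bar>y + of_int m - of_int (k + m)\<bar>" by simp
    then show "z \<in> range (\<lambda>k :: int. \<bar>y + of_int m - of_int k\<bar>)" by blast
  qed
  then show ?thesis by (simp add: dist_int_def)
qed

lemma dist_int_eq_min:
  "\<exists>k :: int. dist_int y = \<bar>y - of_int k\<bar>" "dist_int y \<le> \<bar>y - of_int j\<bar>"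
proof -
  have le: "\<bar>y - of_int (round y)\<bar> \<le> \<bar>y - of_int k\<bar>" for k :: int
    by (metis abs_minus_commute round_diff_minimal)
  have "dist_int y = \<bar>y - of_int (round y)\<bar>"
    unfolding dist_int_def by (rule cInf_eq_minimum) (use le in auto)
  then show "\<exists>k :: int. dist_int y = \<bar>y - of_int k\<bar>" "dist_int y \<le> \<bar>y - of_int j\<bar>"
    using le by auto
qed

lift_definition circle_dist_int :: "circle \<Rightarrow> real" is dist_int
  by (metis Ints_cases add.commute diff_add_cancel dist_int_add_of_int)

lift_definition e_circle :: "circle \<Rightarrow> complex" is "\<lambda>x. exp (2 * \<i> * of_real pi * of_real x)"
proof -
  fix x y :: real assume "x - y \<in> \<int>"
  then obtain m :: int where m: "x = y + of_int m"
    by (metis Ints_cases add.commute diff_add_cancel)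
  have exp_cis: "exp (2 * \<i> * of_real pi * of_real t) = cis (2 * pi * t)" for t :: real
    by (simp add: cis_conv_exp mult_ac)
  have "cis (2 * pi * x) = cis (2 * pi * y) * cis (2 * pi * of_int m)"
    by (simp add: m cis_mult algebra_simps)
  also have "\<dots> = cis (2 * pi * y)"
    by (simp add: cis_multiple_2pi)
  finally show "exp (2 * \<i> * of_real pi * of_real x) = exp (2 * \<i> * of_real pi * of_real y)"
    by (simp only: exp_cis)
qed

definition well_spaced :: "real \<Rightarrow> circle set \<Rightarrow> bool" where
  "well_spaced \<delta> X \<longleftrightarrow> (\<forall>x\<in>X. \<forall>x'\<in>X. x \<noteq> x' \<longrightarrow> circle_dist_int (x - x') \<ge> \<delta>)"

text \<open>Consequently sums over a well-spaced set and its cardinality have their usual meaning.\<close>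

lemma well_spaced_finite:
  assumes "\<delta> > 0" "well_spaced \<delta> X"
  shows "finite X"
proof -
  define r where "r x = frac (rep_circle x)" for x
  define g where "g x = \<lfloor>r x / \<delta>\<rfloor>" for x
  have r: "0 \<le> r x" "r x < 1" for x by (auto simp: r_def frac_lt_1)
  have abs_r: "abs_circle (r x) = x" for x
  proof -
    have "abs_circle (r x) = abs_circle (rep_circle x)"
      by (subst circle.abs_eq_iff) (simp add: r_def frac_def)
    then show ?thesis using Quotient_abs_rep[OF Quotient_circle, of x] by simp
  qed
  have "inj_on g X"
  proof (rule inj_onI, rule ccontr)
    fix x y assume xy: "x \<in> X" "y \<in> X" "g x = g y" "x \<noteq> y"
    have "\<delta> \<le> circle_dist_int (x - y)"
      using assms xy by (auto simp: well_spaced_def)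
    also have "\<dots> = circle_dist_int (abs_circle (r x) - abs_circle (r y))"
      by (simp add: abs_r)
    also have "\<dots> = dist_int (r x - r y)"
      by (simp add: minus_circle.abs_eq circle_dist_int.abs_eq)
    also have "\<dots> \<le> \<bar>r x - r y\<bar>"
      using dist_int_eq_min(2)[of "r x - r y" 0] by simp
    finally have "1 \<le> \<bar>r x / \<delta> - r y / \<delta>\<bar>"
      using assms(1) by (simp add: diff_divide_distrib[symmetric])
    moreover have "\<lfloor>r x / \<delta>\<rfloor> = \<lfloor>r y / \<delta>\<rfloor>" using xy by (simp add: g_def)
    ultimately show False by linarith
  qed
  moreover have "g ` X \<subseteq> {0..\<lfloor>1 / \<delta>\<rfloor>}"
  proof
    fix z assume "z \<in> g ` X"
    then obtain x where z: "z = \<lfloor>r x / \<delta>\<rfloor>" by (auto simp: g_def)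
    have "r x / \<delta> \<le> 1 / \<delta>" "0 \<le> r x / \<delta>"
      using r[of x] assms(1) by (auto simp: divide_right_mono)
    then show "z \<in> {0..\<lfloor>1 / \<delta>\<rfloor>}" by (auto simp: z floor_mono)
  qed
  ultimately show ?thesis by (meson finite_atLeastAtMost_int finite_subset inj_on_finite)
qed

end

theory Submission
  imports Defs "HOL-Analysis.Harmonic_Numbers"
begin

text \<open>
  Write \<open>K = |X|\<close>, \<open>L = log (2 K)\<close> and \<open>W = N + 1/\<delta>\<close>. By duality the theorem is a bound
  for \<open>\<Sum>p |\<Sum>x b(x) e(x p)|\<^sup>2\<close> over the primes \<open>p \<le> N\<close> by \<open>280 (W / log N) L\<close> times
  \<open>\<Sum>x |b(x)|\<^sup>2\<close>. The constant \<open>280\<close> is large enough to dispose of two extreme ranges at once.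
  If \<open>K \<le> 256\<close>, Cauchy's inequality loses only a factor \<open>K\<close> against the number of primes, and
  Chebyshev's bound for that number suffices. If \<open>log N \<le> 46 L\<close>, the large sieve over all
  integers up to \<open>N\<close>, with constant about \<open>6 W\<close>, is already strong enough.

  In the remaining range \<open>K\<close> is a very small power of \<open>N\<close>. The primes up to \<open>R = N\<^sup>1\<^sup>/\<^sup>4\<close> are too few
  to matter. For a prime \<open>n > R\<close> the Selberg sieve provides coefficients \<open>f\<^sub>a\<close> (\<open>coeff\<close>) and
  rational frequencies \<open>y\<^sub>a\<close> (\<open>freq\<close>), with denominators at most \<open>R\<close>, such that \<open>\<Sum>a f\<^sub>a e(n y\<^sub>a) = 1\<close>. Multiplying
  by this sum replaces the frequencies \<open>x\<close> by \<open>x + y\<^sub>a\<close>, after which the sum over primes may be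
  completed to all integers up to \<open>N\<close> and opened with a Fejer kernel (\<open>sieve_dual_bound\<close>). The
  point is to sieve only by primes exceeding \<open>z = 10 K\<close>. The correlation
  \<open>\<Sum> |f\<^sub>a f\<^sub>b|\<close> over \<open>y\<^sub>a - y\<^sub>b = t\<close> equals \<open>1/G\<close> for \<open>t = 0\<close>, but at most \<open>3/(z G)\<close> for every other
  \<open>t\<close> (\<open>sum_pairs_shift_le\<close>). The shifts \<open>t\<close> are spaced by \<open>R\<^sup>-\<^sup>4\<close>, so those with \<open>t \<noteq> 0\<close>
  contribute only \<open>O(W / (z G))\<close> to each of the \<open>K\<close> entries of a row of the quadratic form. In total
  they add \<open>O(W K / (z G)) = O(W / G)\<close>, which is of the size of the contribution of \<open>t = 0\<close> to the row.

  Sieving only by primes above \<open>z\<close> costs a factor \<open>log z\<close>, which is where \<open>log (2 K)\<close> comes from: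
  \<open>log R \<le> \<Sum> 1/n \<le> (2 + 4 T) G\<close> with \<open>T = log z + log 4 + 2\<close> (\<open>sieve_G_ge\<close>). Here each
  \<open>n \<le> R\<close> is split into a \<open>z\<close>-smooth and a \<open>z\<close>-rough part. The reciprocal sum of the smooth parts is
  bounded by a Rankin-type argument from the Mertens bound
  \<open>\<Sum> log p / (p - 1) \<le> T\<close> for \<open>p \<le> z\<close>, itself a consequence of Chebyshev's \<open>\<theta>(n) \<le> n log 4\<close>.
\<close>

section \<open>Chebyshev and Mertens bounds for primes\<close>

lemma prod_primes_dvd:
  fixes n :: nat
  assumes "finite P" "\<And>p. p \<in> P \<Longrightarrow> prime p" "\<And>p. p \<in> P \<Longrightarrow> p dvd n"
  shows "\<Prod>P dvd n"
  using assms
proof (induction P)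
  case (insert p P)
  have "coprime p (\<Prod>P)"
    using insert by (intro prod_coprime_right) (metis insertCI primes_coprime)
  moreover have "p dvd n" "\<Prod>P dvd n" using insert by auto
  ultimately show ?case using insert.hyps by (simp add: divides_mult)
qed auto

text \<open>
  Erdos' induction for Chebyshev's bound: the primes in \<open>(m + 1, 2 m + 1]\<close> all divide the binomial
  coefficient \<open>2 m + 1\<close> over \<open>m\<close>, which occurs twice in its row and hence is at most \<open>4\<^sup>m\<close>.
\<close>

lemma sum_ln_primes_le:
  "(\<Sum>p | prime p \<and> p \<le> n. ln (real p)) \<le> real n * ln 4"
proof (induction n rule: less_induct)
  case (less n)
  let ?\<theta> = "\<lambda>n. \<Sum>p | prime p \<and> p \<le> n. ln (real p)"
  consider "n \<le> 2" | "n > 2" "even n" | m where "n = 2 * m + 1" "m \<ge> 1"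
    by (cases "n \<le> 2"; cases "even n") (auto elim!: oddE)
  then show ?case
  proof cases
    case 1
    show ?thesis
    proof (cases "n = 2")
      case True
      have "{p. prime p \<and> p \<le> n} = {2::nat}"
        using True by (auto intro: antisym prime_ge_2_nat)
      moreover have "ln 2 \<le> 2 * ln (4::real)"
        using ln_le_cancel_iff[of 2 4] ln_ge_zero[of 4] by linarith
      ultimately show ?thesis unfolding True by simp
    next
      case False
      then have "n < 2" using 1 by simp
      then have "{p. prime p \<and> p \<le> n} = {}" by (auto dest: prime_ge_2_nat)
      then show ?thesis by (simp only:) simp
    qed
  next
    case 2
    then have "\<not> prime n" using prime_odd_nat by blast
    then have "{p. prime p \<and> p \<le> n} = {p. prime p \<and> p \<le> n - 1}"
      using le_eq_less_or_eq by (intro Collect_cong) (metis Suc_pred' 2(1) le_SucE le_SucI less_trans pos2)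
    then have "?\<theta> n = ?\<theta> (n - 1)" by simp
    also have "\<dots> \<le> real (n - 1) * ln 4" using 2 by (intro less.IH) auto
    also have "\<dots> \<le> real n * ln 4" by (intro mult_right_mono) auto
    finally show ?thesis .
  next
    case 3
    define Q where "Q = {p. prime p \<and> m + 1 < p \<and> p \<le> n}"
    define b where "b = (2 * m + 1) choose m"
    have fin: "finite Q" by (rule finite_subset[of _ "{..n}"]) (auto simp: Q_def)
    have "b > 0" by (simp add: b_def)
    have "p dvd b" if "p \<in> Q" for p
    proof -
      have p: "prime p" "m + 1 < p" "p \<le> 2 * m + 1" using that 3 by (auto simp: Q_def)
      have "fact m * fact (m + 1) * b = (fact (2 * m + 1) :: nat)"
        using binomial_fact_lemma[of m "2 * m + 1"] by (simp add: b_def)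
      moreover have "p dvd (fact (2 * m + 1) :: nat)" using p by (simp add: prime_dvd_fact_iff del: fact_Suc)
      ultimately have "p dvd (fact m * fact (m + 1) * b)" by simp
      then show ?thesis
        using p by (auto simp: prime_dvd_mult_iff prime_dvd_fact_iff simp del: fact_Suc)
    qed
    then have "\<Prod>Q dvd b" by (intro prod_primes_dvd fin) (auto simp: Q_def)
    then have "\<Prod>Q \<le> b" using \<open>b > 0\<close> by (rule dvd_imp_le)
    moreover have "b \<le> 4 ^ m"
    proof -
      have "2 * b = ((2 * m + 1) choose m) + ((2 * m + 1) choose (m + 1))"
        using binomial_symmetric[of m "2 * m + 1"] by (simp add: b_def)
      also have "\<dots> = (\<Sum>k\<in>{m, m + 1}. (2 * m + 1) choose k)" by simp
      also have "\<dots> \<le> (\<Sum>k\<le>2 * m + 1. (2 * m + 1) choose k)" by (intro sum_mono2) auto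
      also have "\<dots> = 2 * 4 ^ m" by (simp only: choose_row_sum) (simp add: power_mult)
      finally show ?thesis by simp
    qed
    ultimately have "\<Prod>Q \<le> 4 ^ m" by simp
    then have "real (\<Prod>Q) \<le> 4 ^ m" using of_nat_mono[of "\<Prod>Q" "4 ^ m", where 'a=real] by simp
    moreover have "real (\<Prod>Q) > 0" 
      by (auto simp: Q_def prime_gt_0_nat intro!: prod_pos)
    ultimately have "ln (real (\<Prod>Q)) \<le> ln (4 ^ m)" by simp
    moreover have "ln (real (\<Prod>Q)) = (\<Sum>p\<in>Q. ln (real p))"
      by (simp, intro ln_prod fin) (auto simp: Q_def)
    ultimately have "(\<Sum>p\<in>Q. ln (real p)) \<le> m * ln 4" by (simp add: ln_realpow)
    moreover have "?\<theta> (m + 1) \<le> real (m + 1) * ln 4" using 3 by (intro less.IH) auto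
    moreover have "?\<theta> n = ?\<theta> (m + 1) + (\<Sum>p\<in>Q. ln (real p))"
    proof -
      have "{p. prime p \<and> p \<le> n} = {p. prime p \<and> p \<le> m + 1} \<union> Q" using 3 by (auto simp: Q_def)
      then show ?thesis using fin by (simp only:) (intro sum.union_disjoint, auto simp: Q_def)
    qed
    ultimately show ?thesis using 3 by (simp add: algebra_simps)
  qed
qed

lemma ln_nat_eq_sum_multiplicity:
  assumes "n > (0::nat)"
  shows "ln (real n) = (\<Sum>p\<in>prime_factors n. real (multiplicity p n) * ln (real p))"
proof -
  have "real n = real (\<Prod>p\<in>prime_factors n. p ^ multiplicity p n)"
    using assms prod_prime_factors[of n] by simp
  then have "ln (real n) = ln (\<Prod>p\<in>prime_factors n. real p ^ multiplicity p n)" by simp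
  also have "\<dots> = (\<Sum>p\<in>prime_factors n. ln (real p ^ multiplicity p n))"
    by (intro ln_prod) (auto simp: in_prime_factors_iff)
  also have "\<dots> = (\<Sum>p\<in>prime_factors n. real (multiplicity p n) * ln (real p))"
    by (intro sum.cong refl) (simp add: ln_realpow)
  finally show ?thesis .
qed

text \<open>
  Mertens' bound comes from counting the prime factors of \<open>n!\<close>: the prime \<open>p\<close> divides
  \<open>n div p > n / p - 1\<close> of the factors \<open>1, \<dots>, n\<close>, so that
  \<open>\<Sum> (n / p - 1) log p \<le> log n! \<le> n log n\<close>; the terms \<open>- log p\<close> cost at most \<open>n log 4\<close>.
\<close>

lemma sum_ln_div_primes_le:
  assumes "n > 0"
  shows "(\<Sum>p | prime p \<and> p \<le> n. ln (real p) / real p) \<le> ln (real n) + ln 4"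
proof -
  define P where "P = {p. prime p \<and> p \<le> n}"
  have fin: "finite P" by (rule finite_subset[of _ "{..n}"]) (auto simp: P_def)
  have "(\<Sum>p\<in>P. ln (real p) * (real n / real p - 1)) \<le> (\<Sum>p\<in>P. ln (real p) * real (n div p))"
  proof (intro sum_mono mult_left_mono)
    fix p assume "p \<in> P"
    then have p: "prime p" by (auto simp: P_def)
    have "real n / real p = real (n div p) + real (n mod p) / real p"
      using p prime_gt_0_nat[OF p] by (simp add: field_simps flip: of_nat_add of_nat_mult)
    moreover have "real (n mod p) / real p \<le> 1" using p prime_gt_0_nat by simp
    ultimately show "real n / real p - 1 \<le> real (n div p)" by simp
    show "0 \<le> ln (real p)" using prime_ge_1_nat[OF p] by simp
  qed
  also have "\<dots> = (\<Sum>p\<in>P. \<Sum>k | k \<in> {1..n} \<and> p dvd k. ln (real p))"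
  proof (intro sum.cong refl)
    fix p assume "p \<in> P"
    then have p: "p > 0" using prime_gt_0_nat by (auto simp: P_def)
    have "{k \<in> {1..n}. p dvd k} = (*) p ` {1..n div p}"
    proof (intro equalityI subsetI)
      fix k assume "k \<in> {k \<in> {1..n}. p dvd k}"
      then obtain j where "k = p * j" "1 \<le> k" "k \<le> n" by (auto elim: dvdE)
      then show "k \<in> (*) p ` {1..n div p}" using p by (auto simp: less_eq_div_iff_mult_less_eq mult.commute)
    next
      fix k assume "k \<in> (*) p ` {1..n div p}"
      then show "k \<in> {k \<in> {1..n}. p dvd k}" using p by (auto simp: less_eq_div_iff_mult_less_eq mult.commute)
    qed
    moreover have "inj_on ((*) p) {1..n div p}" using p by (auto simp: inj_on_def)
    ultimately have "card {k \<in> {1..n}. p dvd k} = n div p" by (simp add: card_image)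
    then show "ln (real p) * real (n div p) = (\<Sum>k | k \<in> {1..n} \<and> p dvd k. ln (real p))" by simp
  qed
  also have "\<dots> = (\<Sum>k\<in>{1..n}. \<Sum>p | p \<in> P \<and> p dvd k. ln (real p))"
    by (rule sum.swap_restrict[OF fin]) auto
  also have "\<dots> \<le> (\<Sum>k\<in>{1..n}. ln (real k))"
  proof (intro sum_mono)
    fix k assume k: "k \<in> {1..n}"
    have "(\<Sum>p | p \<in> P \<and> p dvd k. ln (real p)) = (\<Sum>p\<in>prime_factors k. ln (real p))"
      using k by (intro sum.cong refl) (auto simp: P_def in_prime_factors_iff intro: order_trans[OF dvd_imp_le])
    also have "\<dots> \<le> (\<Sum>p\<in>prime_factors k. real (multiplicity p k) * ln (real p))"
    proof (intro sum_mono)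
      fix p assume p: "p \<in> prime_factors k"
      then have "multiplicity p k \<ge> 1" using k by (simp add: prime_factors_multiplicity Suc_leI)
      moreover have "ln (real p) \<ge> 0" using p prime_ge_1_nat by (auto simp: in_prime_factors_iff)
      ultimately show "ln (real p) \<le> real (multiplicity p k) * ln (real p)"
        by (simp add: mult_le_cancel_right1)
    qed
    also have "\<dots> = ln (real k)" using k by (intro ln_nat_eq_sum_multiplicity[symmetric]) auto
    finally show "(\<Sum>p | p \<in> P \<and> p dvd k. ln (real p)) \<le> ln (real k)" .
  qed
  also have "\<dots> \<le> (\<Sum>k\<in>{1..n}. ln (real n))" by (intro sum_mono) auto
  also have "\<dots> = real n * ln (real n)" by simp
  finally have "(\<Sum>p\<in>P. ln (real p) * (real n / real p - 1)) \<le> real n * ln (real n)" .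
  moreover have "(\<Sum>p\<in>P. ln (real p) * (real n / real p - 1)) 
     = real n * (\<Sum>p\<in>P. ln (real p) / real p) - (\<Sum>p\<in>P. ln (real p))"
    by (simp add: sum_distrib_left sum_subtractf algebra_simps)
  moreover have "(\<Sum>p\<in>P. ln (real p)) \<le> real n * ln 4"
    using sum_ln_primes_le[of n] by (simp add: P_def)
  ultimately have "real n * (\<Sum>p\<in>P. ln (real p) / real p) \<le> real n * (ln (real n) + ln 4)"
    by (simp add: algebra_simps)
  then show ?thesis using assms by (simp add: P_def)
qed

lemma ln_one_plus_square_le: "x \<ge> 0 \<Longrightarrow> ln (1 + x\<^sup>2) \<le> (x::real)"
proof -
  assume x: "x \<ge> 0"
  have "((\<lambda>x. x - ln (1 + x\<^sup>2)) has_real_derivative (1 - 2 * t / (1 + t\<^sup>2))) (at t)" for t :: real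
    using sum_power2_gt_zero_iff[of 1 t] by (auto intro!: derivative_eq_intros simp: field_simps)
  moreover have "1 - 2 * t / (1 + t\<^sup>2) \<ge> 0" for t :: real
    using zero_le_power2[of "1 - t"] sum_power2_gt_zero_iff[of 1 t]
    by (simp add: power2_diff divide_simps)
  ultimately have "0 - ln (1 + 0\<^sup>2) \<le> x - ln (1 + x\<^sup>2)"
    by (intro DERIV_nonneg_imp_nondecreasing[OF x]) blast
  then show ?thesis by simp
qed

text \<open>
  By \<open>log k \<le> \<surd>(k - 1)\<close> the terms are dominated by the telescoping differences of \<open>2 / \<surd>(k - 1)\<close>.
\<close>

lemma sum_ln_div_square_le:
  "(\<Sum>k\<in>{2..n}. ln (real k) / (real k * (real k - 1))) \<le> 2"
proof -
  have step_le: "ln (real k) / (real k * (real k - 1)) \<le> 2 / sqrt (real k - 1) - 2 / sqrt (real k)"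
    if "k \<ge> 2" for k
  proof -
    define a b where "a = sqrt (real k - 1)" and "b = sqrt (real k)"
    have ab: "a > 0" "b > 0" "a \<le> b" "b\<^sup>2 = real k" "a\<^sup>2 = real k - 1"
      using that by (auto simp: a_def b_def)
    have "ln (real k) \<le> a" using ln_one_plus_square_le[of a] ab by simp
    then have "ln (real k) / (real k * (real k - 1)) \<le> a / (b\<^sup>2 * a\<^sup>2)"
      unfolding ab using that by (intro divide_right_mono) auto
    also have "\<dots> = 1 / (a * b * b)" using ab by (simp add: field_simps power2_eq_square)
    also have "\<dots> = 2 / (a * b * (b + b))" using ab by (simp add: field_simps)
    also have "\<dots> \<le> 2 / (a * b * (a + b))"
      using ab by (intro divide_left_mono mult_left_mono mult_pos_pos add_right_mono) auto
    also have "\<dots> = 2 * (b\<^sup>2 - a\<^sup>2) / (a * b * (a + b))" using ab by simp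
    also have "b\<^sup>2 - a\<^sup>2 = (b - a) * (a + b)" by (simp add: power2_eq_square algebra_simps)
    also have "2 * ((b - a) * (a + b)) / (a * b * (a + b)) = 2 * (b - a) / (a * b)"
      using ab by simp
    also have "\<dots> = 2 / a - 2 / b" using ab by (simp add: diff_divide_distrib right_diff_distrib)
    finally show ?thesis by (simp add: a_def b_def)
  qed
  have "(\<Sum>k\<in>{2..n}. ln (real k) / (real k * (real k - 1))) \<le> 2 - 2 / sqrt (real n)" if "n \<ge> 1"
    using that
  proof (induction n rule: dec_induct)
    case (step n)
    have "{2..Suc n} = insert (Suc n) {2..n}" using step by auto
    then show ?case using step.IH \<open>1 \<le> n\<close> step_le[of "Suc n"] by simp
  qed auto
  moreover have "2 / sqrt (real n) \<ge> 0" by simp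
  ultimately show ?thesis by (cases "n = 0") (auto intro: order_trans)
qed

lemma sum_ln_div_pred_primes_le:
  assumes "n > 0"
  shows "(\<Sum>p | prime p \<and> p \<le> n. ln (real p) / (real p - 1)) \<le> ln (real n) + ln 4 + 2"
proof -
  have "(\<Sum>p | prime p \<and> p \<le> n. ln (real p) / (real p - 1)) =
     (\<Sum>p | prime p \<and> p \<le> n. ln (real p) / real p) + 
     (\<Sum>p | prime p \<and> p \<le> n. ln (real p) / (real p * (real p - 1)))"
    unfolding sum.distrib[symmetric]
  proof (intro sum.cong refl)
    fix p assume "p \<in> {p. prime p \<and> p \<le> n}"
    then have "real p \<ge> 2" using prime_ge_2_nat by auto
    then show "ln (real p) / (real p - 1) = ln (real p) / real p + ln (real p) / (real p * (real p - 1))"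
      by (simp add: divide_simps) (simp add: algebra_simps)
  qed
  also have "(\<Sum>p | prime p \<and> p \<le> n. ln (real p) / (real p * (real p - 1)))
     \<le> (\<Sum>k\<in>{2..n}. ln (real k) / (real k * (real k - 1)))"
    by (intro sum_mono2) (auto dest: prime_ge_2_nat)
  also note sum_ln_div_square_le
  finally show ?thesis using sum_ln_div_primes_le[OF assms] by simp
qed

section \<open>Reciprocal sums over smooth integers\<close>

lemma harm_le_ln: "n \<ge> 1 \<Longrightarrow> harm n \<le> 1 + ln (real n)"
proof (induction n rule: dec_induct)
  case (step n)
  have "ln (real n / real (Suc n)) \<le> real n / real (Suc n) - 1"
    using step by (intro ln_le_minus_one) auto
  also have "\<dots> = - inverse (real (Suc n))" by (simp add: field_simps)
  finally show ?case using step by (simp add: harm_Suc ln_div)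
qed (simp add: harm_def)

lemma sum_inverse_le:
  assumes "finite A" "\<And>n. n \<in> A \<Longrightarrow> n \<ge> 1 \<and> ln (real n) \<le> C" "C \<ge> 0"
  shows "(\<Sum>n\<in>A. 1 / real n) \<le> 1 + C"
proof -
  define m where "m = nat \<lfloor>exp C\<rfloor>"
  have m: "m \<ge> 1" using assms(3) by (simp add: m_def le_nat_iff)
  have "A \<subseteq> {1..m}"
  proof
    fix n assume n: "n \<in> A"
    then have "real n \<le> exp C" using assms(2)[OF n]
      by (metis exp_le_cancel_iff exp_ln less_le_trans of_nat_0_less_iff zero_less_one)
    then show "n \<in> {1..m}" using assms(2)[OF n] by (simp add: m_def le_nat_floor)
  qed
  then have "(\<Sum>n\<in>A. 1 / real n) \<le> (\<Sum>n\<in>{1..m}. 1 / real n)" by (intro sum_mono2) auto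
  also have "\<dots> = harm m" by (simp add: harm_def divide_inverse)
  also have "\<dots> \<le> 1 + ln (real m)" by (rule harm_le_ln[OF m])
  also have "real m \<le> exp C" by (simp add: m_def)
  then have "ln (real m) \<le> C" using m by (metis ln_exp ln_le_cancel_iff exp_gt_zero of_nat_0_less_iff less_le_trans zero_less_one)
  finally show ?thesis by simp
qed

text \<open>
  Removing one factor \<open>p\<close> maps the multiples of \<open>p\<close> in \<open>A\<close> injectively into \<open>A\<close> and lowers the
  multiplicity by one. Hence the left side \<open>V\<close> and the reciprocal sum \<open>H\<close> satisfy \<open>V \<le> (H + V) / p\<close>.
\<close>

lemma sum_multiplicity_le:
  assumes fin: "finite A" and p: "prime p" and A0: "\<And>n. n \<in> A \<Longrightarrow> n \<ge> 1"
    and closed: "\<And>n. p * n \<in> A \<Longrightarrow> n \<in> A"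
  shows "(\<Sum>n\<in>A. real (multiplicity p n) / real n) \<le> (\<Sum>n\<in>A. 1 / real n) / (real p - 1)"
proof -
  have p2: "real p \<ge> 2" using prime_ge_2_nat[OF p] by simp
  define V where "V = (\<Sum>n\<in>A. real (multiplicity p n) / real n)"
  define B where "B = {n. p * n \<in> A}"
  have B: "B \<subseteq> A" using closed by (auto simp: B_def)
  have "V = (\<Sum>n\<in>(*) p ` B. real (multiplicity p n) / real n)"
    unfolding V_def
  proof (rule sum.mono_neutral_right[OF fin])
    show "(*) p ` B \<subseteq> A" by (auto simp: B_def)
    show "\<forall>n\<in>A - (*) p ` B. real (multiplicity p n) / real n = 0"
      by (auto simp: B_def not_dvd_imp_multiplicity_0 elim!: dvdE)
         (metis (mono_tags, lifting) DiffE dvdE imageI mem_Collect_eq not_dvd_imp_multiplicity_0)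
  qed
  also have "\<dots> = (\<Sum>n\<in>B. real (multiplicity p (p * n)) / real (p * n))"
    using p2 by (subst sum.reindex) (auto simp: inj_on_def)
  also have "\<dots> = (\<Sum>n\<in>B. (1 + real (multiplicity p n)) / real n) / real p"
    unfolding sum_divide_distrib
  proof (intro sum.cong refl)
    fix n assume "n \<in> B"
    then have "n \<ge> 1" using A0 B by blast
    then have "multiplicity p (p * n) = Suc (multiplicity p n)"
      using p by (intro multiplicity_times_same) auto
    then show "real (multiplicity p (p * n)) / real (p * n) = (1 + real (multiplicity p n)) / real n / real p"
      by simp
  qed
  also have "\<dots> \<le> (\<Sum>n\<in>A. (1 + real (multiplicity p n)) / real n) / real p"
    using fin B by (intro divide_right_mono sum_mono2) auto
  also have "\<dots> = ((\<Sum>n\<in>A. 1 / real n) + V) / real p"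
    by (simp add: V_def sum.distrib add_divide_distrib)
  finally have "V * (real p - 1) \<le> (\<Sum>n\<in>A. 1 / real n)" using p2 by (simp add: field_simps)
  then show ?thesis using p2 by (simp add: V_def field_simps)
qed

text \<open>
  The sum \<open>H\<close> on the left satisfies \<open>\<Sum> log n / n \<le> T H\<close>, because every prime \<open>p \<le> z\<close> contributes
  at most \<open>H log p / (p - 1)\<close> to the left side. So the integers with \<open>log n > 2 T\<close> carry at most half of \<open>H\<close>,
  and the others carry at most \<open>1 + 2 T\<close>. The bound does not depend on \<open>Y\<close>; it stands in for
  the Euler product over \<open>p \<le> z\<close>.
\<close>

lemma sum_inverse_smooth_le:
  assumes z: "z \<ge> 1" and T: "T = ln (real z) + ln 4 + 2"
  shows "(\<Sum>n | 1 \<le> n \<and> n \<le> Y \<and> (\<forall>p\<in>prime_factors n. p \<le> z). 1 / real n) \<le> 2 + 4 * T"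
proof -
  define A where "A = {n. 1 \<le> n \<and> n \<le> Y \<and> (\<forall>p\<in>prime_factors n. p \<le> z)}"
  define H where "H = (\<Sum>n\<in>A. 1 / real n)"
  define P where "P = {p. prime p \<and> p \<le> z}"
  have T0: "T > 0" using z by (simp add: T add_nonneg_pos)
  have finP: "finite P" by (rule finite_subset[of _ "{..z}"]) (auto simp: P_def)
  have fin: "finite A" by (rule finite_subset[of _ "{..Y}"]) (auto simp: A_def)
  have H0: "H \<ge> 0" by (simp add: H_def sum_nonneg)
  have "(\<Sum>n\<in>A. ln (real n) / real n) = (\<Sum>n\<in>A. \<Sum>p\<in>P. ln (real p) * (real (multiplicity p n) / real n))"
  proof (intro sum.cong refl)
    fix n assume n: "n \<in> A"
    then have "ln (real n) = (\<Sum>p\<in>prime_factors n. real (multiplicity p n) * ln (real p))"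
      by (intro ln_nat_eq_sum_multiplicity) (auto simp: A_def)
    also have "\<dots> = (\<Sum>p\<in>P. real (multiplicity p n) * ln (real p))"
      using n finP by (intro sum.mono_neutral_left)
        (auto simp: P_def A_def prime_factors_multiplicity)
    finally show "ln (real n) / real n = (\<Sum>p\<in>P. ln (real p) * (real (multiplicity p n) / real n))"
      by (simp add: sum_divide_distrib mult.commute)
  qed
  also have "\<dots> = (\<Sum>p\<in>P. ln (real p) * (\<Sum>n\<in>A. real (multiplicity p n) / real n))"
    by (subst sum.swap) (simp add: sum_distrib_left)
  also have "\<dots> \<le> (\<Sum>p\<in>P. ln (real p) * (H / (real p - 1)))"
    unfolding H_def
  proof (intro sum_mono mult_left_mono sum_multiplicity_le fin)
    fix p assume p: "p \<in> P"
    then show "prime p" by (simp add: P_def)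
    show "ln (real p) \<ge> 0" using p prime_ge_1_nat by (auto simp: P_def)
    show "n \<in> A" if "p * n \<in> A" for n
    proof -
      have pn: "1 \<le> p * n" "p * n \<le> Y" "\<forall>q\<in>prime_factors (p * n). q \<le> z" using that by (auto simp: A_def)
      then have n1: "n \<ge> 1" "p \<ge> 1" by (auto simp: Suc_le_eq)
      then have "n \<le> p * n" by simp
      moreover have "prime_factors n \<subseteq> prime_factors (p * n)"
        using n1 by (intro dvd_prime_factors) auto
      ultimately show ?thesis using pn n1 le_trans[of n "p * n" Y] by (auto simp: A_def)
    qed
  qed (auto simp: A_def)
  also have "\<dots> = H * (\<Sum>p\<in>P. ln (real p) / (real p - 1))" by (simp add: sum_distrib_left mult_ac)
  also have "\<dots> \<le> H * T"
    using sum_ln_div_pred_primes_le[of z] z H0 by (intro mult_left_mono) (auto simp: P_def T)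
  finally have lnsum: "(\<Sum>n\<in>A. ln (real n) / real n) \<le> H * T" .
  have "H = (\<Sum>n\<in>{n\<in>A. ln (real n) \<le> 2 * T}. 1 / real n) + (\<Sum>n\<in>{n\<in>A. \<not> ln (real n) \<le> 2 * T}. 1 / real n)"
    unfolding H_def by (subst sum.union_disjoint[symmetric]) (auto intro!: sum.cong fin)
  also have "(\<Sum>n\<in>{n\<in>A. ln (real n) \<le> 2 * T}. 1 / real n) \<le> 1 + 2 * T"
    using T0 fin by (intro sum_inverse_le) (auto simp: A_def)
  also have "(\<Sum>n\<in>{n\<in>A. \<not> ln (real n) \<le> 2 * T}. 1 / real n)
     \<le> (\<Sum>n\<in>{n\<in>A. \<not> ln (real n) \<le> 2 * T}. (1 / (2 * T)) * (ln (real n) / real n))"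
  proof (intro sum_mono)
    fix n assume "n \<in> {n\<in>A. \<not> ln (real n) \<le> 2 * T}"
    then have "n \<ge> 1" "ln (real n) \<ge> 2 * T" by (auto simp: A_def)
    then show "1 / real n \<le> (1 / (2 * T)) * (ln (real n) / real n)"
      using T0 by (simp add: field_simps)
  qed
  also have "\<dots> \<le> (\<Sum>n\<in>A. (1 / (2 * T)) * (ln (real n) / real n))"
    using T0 fin by (intro sum_mono2) (auto simp: A_def)
  also have "\<dots> = (1 / (2 * T)) * (\<Sum>n\<in>A. ln (real n) / real n)" by (simp add: sum_distrib_left)
  also have "\<dots> \<le> (1 / (2 * T)) * (H * T)" using lnsum T0 by (intro mult_left_mono) auto
  also have "\<dots> = H / 2" using T0 by simp
  finally show ?thesis by (simp add: H_def A_def)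
qed

section \<open>The Fejer kernel and the large sieve\<close>

definition ee :: "real \<Rightarrow> complex" where "ee t = cis (2 * pi * t)"

lemma ee_0 [simp]: "ee 0 = 1" by (simp add: ee_def)
lemma ee_add: "ee (s + t) = ee s * ee t" by (simp add: ee_def cis_mult algebra_simps)
lemma ee_diff: "ee (s - t) = ee s * cnj (ee t)"
  by (simp add: ee_def cis_cnj cis_mult algebra_simps)
lemma norm_ee [simp]: "cmod (ee t) = 1" by (simp add: ee_def)
lemma ee_of_int [simp]: "ee (of_int k) = 1" by (simp add: ee_def)
lemma ee_nat_mult: "ee (real n * t) = ee t ^ n" using Complex.DeMoivre[of "2 * pi * t" n] by (simp add: ee_def mult.left_commute)
lemma ee_add_of_int: "ee (t + of_int k) = ee t" by (simp add: ee_add)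
lemma ee_sum: "ee (\<Sum>i\<in>A. f i) = (\<Prod>i\<in>A. ee (f i))"
  by (induction A rule: infinite_finite_induct) (simp_all add: ee_add)

lemma dist_int_eq_round: "dist_int y = \<bar>y - of_int (round y)\<bar>"
proof (rule antisym)
  show "dist_int y \<le> \<bar>y - of_int (round y)\<bar>" by (rule dist_int_eq_min(2))
  obtain k :: int where "dist_int y = \<bar>y - of_int k\<bar>" using dist_int_eq_min(1) by blast
  then show "\<bar>y - of_int (round y)\<bar> \<le> dist_int y"
    by (metis abs_minus_commute round_diff_minimal)
qed

lemma dist_int_nonneg: "dist_int y \<ge> 0" and dist_int_le_half: "dist_int y \<le> 1 / 2"
  using of_int_round_abs_le[of y] by (auto simp: dist_int_eq_round abs_minus_commute)

lemma sin_ge_chord: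
  assumes "0 \<le> x" "x \<le> pi / 2"
  shows "sin x \<ge> 2 / pi * x"
proof -
  have "concave_on {0..pi / 2} sin"
    by (rule f''_le0_imp_concave[where f' = cos and f'' = "\<lambda>x. - sin x"])
       (auto intro!: derivative_eq_intros sin_ge_zero)
  then have "sin ((1 - t) *\<^sub>R 0 + t *\<^sub>R (pi / 2)) \<ge> (1 - t) * sin 0 + t * sin (pi / 2)"
    if "0 \<le> t" "t \<le> 1" for t
    using that by (intro concave_onD) auto
  from this[of "2 / pi * x"] show ?thesis using assms by (simp add: field_simps)
qed

lemma norm_one_minus_ee_ge: "cmod (1 - ee t) \<ge> 4 * dist_int t"
proof -
  define s where "s = t - of_int (round t)"
  have s: "\<bar>s\<bar> = dist_int t" "\<bar>s\<bar> \<le> 1 / 2"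
    using dist_int_le_half[of t] by (auto simp: s_def dist_int_eq_round)
  have "ee t = ee s" using ee_add_of_int[of s "round t"] by (simp add: s_def)
  have "(cmod (1 - ee s))\<^sup>2 = (1 - cos (2 * (pi * s)))\<^sup>2 + (sin (2 * (pi * s)))\<^sup>2"
    by (simp add: ee_def cmod_power2 mult.assoc)
  also have "\<dots> = 2 - 2 * cos (2 * (pi * s))"
    by (simp add: power2_diff sin_squared_eq)
  also have "\<dots> = (2 * sin (pi * \<bar>s\<bar>))\<^sup>2"
    by (simp only: cos_double_sin) (simp add: abs_if power_mult_distrib)
  finally have "cmod (1 - ee s) = \<bar>2 * sin (pi * \<bar>s\<bar>)\<bar>"
    by (metis abs_norm_cancel power2_abs abs_ge_zero power2_eq_imp_eq)
  moreover have "sin (pi * \<bar>s\<bar>) \<ge> 2 / pi * (pi * \<bar>s\<bar>)"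
    using s by (intro sin_ge_chord) auto
  ultimately show ?thesis using s \<open>ee t = ee s\<close> by simp
qed

text \<open>
  This is \<open>M\<close> times the Fejer kernel.
\<close>

definition fejer :: "nat \<Rightarrow> real \<Rightarrow> real" where
  "fejer M t = (cmod (\<Sum>m<M. ee (real m * t)))\<^sup>2"

lemma fejer_nonneg [simp]: "fejer M t \<ge> 0" by (simp add: fejer_def)

lemma fejer_add_of_int: "fejer M (t + of_int k) = fejer M t"
  by (simp add: fejer_def ee_nat_mult ee_add_of_int)

lemma fejer_minus: "fejer M (- t) = fejer M t"
proof -
  have "(\<Sum>m<M. ee (real m * - t)) = cnj (\<Sum>m<M. ee (real m * t))"
    by (simp add: ee_def cis_cnj)
  then show ?thesis by (simp only: fejer_def complex_mod_cnj)
qed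

lemma fejer_le: "fejer M t \<le> (real M)\<^sup>2"
proof -
  have "cmod (\<Sum>m<M. ee (real m * t)) \<le> real M"
    by (rule order_trans[OF norm_sum]) simp
  then show ?thesis by (simp add: fejer_def power_mono)
qed

lemma fejer_le_dist:
  assumes "dist_int t > 0"
  shows "fejer M t \<le> 1 / (4 * (dist_int t)\<^sup>2)"
proof -
  define D where "D = (\<Sum>m<M. ee (real m * t))"
  have "(1 - ee t) * D = 1 - ee t ^ M" by (simp add: D_def ee_nat_mult one_diff_power_eq)
  then have "cmod (1 - ee t) * cmod D = cmod (1 - ee t ^ M)" by (metis norm_mult)
  also have "\<dots> \<le> cmod 1 + cmod (ee t ^ M)" by (rule norm_triangle_ineq4)
  also have "\<dots> = 2" by (simp add: norm_power)
  finally have "4 * dist_int t * cmod D \<le> 2"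
    using mult_right_mono[OF norm_one_minus_ee_ge[of t], of "cmod D"] by simp
  then have "cmod D \<le> 1 / (2 * dist_int t)" using assms by (simp add: field_simps)
  then have "(cmod D)\<^sup>2 \<le> (1 / (2 * dist_int t))\<^sup>2" by (intro power_mono) auto
  then show ?thesis by (simp add: fejer_def D_def power_divide power_mult_distrib)
qed

text \<open>
  The differences \<open>j - k\<close> with \<open>0 \<le> j, k < M\<close>, translated to the middle of \<open>1, \<dots>, N\<close>, hit each
  \<open>n \<le> N \<le> M\<close> at least \<open>M / 2\<close> times. Averaging \<open>|S(j - k + a)|\<^sup>2\<close> over \<open>j\<close> and \<open>k\<close> therefore majorises
  the sum over \<open>n\<close>, and opening the square makes the sums over \<open>j\<close> and \<open>k\<close> factor into a Fejer
  kernel; the translation \<open>a\<close> only contributes a factor of modulus one.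
\<close>

lemma sum_norm_power2_le_fejer:
  fixes c :: "'i \<Rightarrow> complex" and \<xi> :: "'i \<Rightarrow> real"
  assumes "finite I" "N \<le> M" "M > 0"
  shows "(\<Sum>n\<in>{1..N}. (cmod (\<Sum>i\<in>I. c i * ee (real n * \<xi> i)))\<^sup>2)
    \<le> 2 / real M * (\<Sum>i\<in>I. \<Sum>j\<in>I. cmod (c i) * cmod (c j) * fejer M (\<xi> i - \<xi> j))"
proof -
  define S :: "int \<Rightarrow> complex" where "S r = (\<Sum>i\<in>I. c i * ee (of_int r * \<xi> i))" for r
  define a :: int where "a = int ((N + 1) div 2)"
  define h where "h = (\<lambda>(j, k). int j - int k + a)"
  define Q where "Q = {..<M} \<times> {..<M}"
  have finQ: "finite Q" by (simp add: Q_def)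
  have hits: "real M / 2 \<le> real (card {q \<in> Q. h q = int n})" if n: "n \<in> {1..N}" for n
  proof -
    define d where "d = nat \<bar>int n - a\<bar>"
    have d: "2 * d \<le> M" using n assms(2) by (auto simp: d_def a_def)
    have "inj_on (\<lambda>k. if int n \<ge> a then (k + d, k) else (k, k + d)) {..<M - d}"
      by (auto simp: inj_on_def split: if_splits)
    moreover have "(\<lambda>k. if int n \<ge> a then (k + d, k) else (k, k + d)) ` {..<M - d} \<subseteq> {q \<in> Q. h q = int n}"
      by (auto simp: Q_def h_def d_def)
    ultimately have "card {..<M - d} \<le> card {q \<in> Q. h q = int n}"
      by (rule card_inj_on_le) (simp add: finQ)
    then show ?thesis using d by simp
  qed
  have "real M / 2 * (\<Sum>n\<in>{1..N}. (cmod (\<Sum>i\<in>I. c i * ee (real n * \<xi> i)))\<^sup>2)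
      = (\<Sum>n\<in>{1..N}. real M / 2 * (cmod (S (int n)))\<^sup>2)"
    by (simp add: sum_distrib_left S_def)
  also have "\<dots> \<le> (\<Sum>n\<in>{1..N}. real (card {q \<in> Q. h q = int n}) * (cmod (S (int n)))\<^sup>2)"
    by (intro sum_mono mult_right_mono hits) auto
  also have "\<dots> = (\<Sum>n\<in>{1..N}. \<Sum>q\<in>{q \<in> Q. h q = int n}. (cmod (S (h q)))\<^sup>2)"
    by simp
  also have "\<dots> = (\<Sum>q\<in>(\<Union>n\<in>{1..N}. {q \<in> Q. h q = int n}). (cmod (S (h q)))\<^sup>2)"
    by (rule sum.UNION_disjoint[symmetric]) (auto simp: finQ)
  also have "\<dots> \<le> (\<Sum>q\<in>Q. (cmod (S (h q)))\<^sup>2)"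
    by (intro sum_mono2) (auto simp: finQ)
  also have "\<dots> \<le> (\<Sum>i\<in>I. \<Sum>j\<in>I. cmod (c i) * cmod (c j) * fejer M (\<xi> i - \<xi> j))"
  proof -
    have sq: "complex_of_real ((cmod (S (h q)))\<^sup>2) =
      (\<Sum>i\<in>I. \<Sum>j\<in>I. c i * cnj (c j) * ee (of_int a * (\<xi> i - \<xi> j)) *
        (ee (real (fst q) * (\<xi> i - \<xi> j)) * cnj (ee (real (snd q) * (\<xi> i - \<xi> j)))))" for q
    proof -
      have "complex_of_real ((cmod (S (h q)))\<^sup>2) = S (h q) * cnj (S (h q))"
        using complex_norm_square[of "S (h q)"] by simp
      also have "\<dots> = (\<Sum>i\<in>I. \<Sum>j\<in>I. (c i * ee (of_int (h q) * \<xi> i)) * cnj (c j * ee (of_int (h q) * \<xi> j)))"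
        by (simp add: S_def sum_product)
      also have "\<dots> = (\<Sum>i\<in>I. \<Sum>j\<in>I. c i * cnj (c j) * ee (of_int (h q) * (\<xi> i - \<xi> j)))"
        by (intro sum.cong refl) (simp add: right_diff_distrib ee_diff mult_ac)
      also have "\<dots> = (\<Sum>i\<in>I. \<Sum>j\<in>I. c i * cnj (c j) * ee (of_int a * (\<xi> i - \<xi> j)) *
        (ee (real (fst q) * (\<xi> i - \<xi> j)) * cnj (ee (real (snd q) * (\<xi> i - \<xi> j)))))"
      proof (intro sum.cong refl)
        fix i j
        have "of_int (h q) * (\<xi> i - \<xi> j) = of_int a * (\<xi> i - \<xi> j) +
           (real (fst q) * (\<xi> i - \<xi> j) - real (snd q) * (\<xi> i - \<xi> j))"
          by (simp add: h_def split_beta algebra_simps)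
        then show "c i * cnj (c j) * ee (of_int (h q) * (\<xi> i - \<xi> j)) = 
           c i * cnj (c j) * ee (of_int a * (\<xi> i - \<xi> j)) *
           (ee (real (fst q) * (\<xi> i - \<xi> j)) * cnj (ee (real (snd q) * (\<xi> i - \<xi> j))))"
          by (simp only: ee_add ee_diff mult.assoc)
      qed
      finally show ?thesis .
    qed
    have "complex_of_real (\<Sum>q\<in>Q. (cmod (S (h q)))\<^sup>2) =
      (\<Sum>i\<in>I. \<Sum>j\<in>I. c i * cnj (c j) * ee (of_int a * (\<xi> i - \<xi> j)) *
        (\<Sum>q\<in>Q. ee (real (fst q) * (\<xi> i - \<xi> j)) * cnj (ee (real (snd q) * (\<xi> i - \<xi> j)))))"
      unfolding of_real_sum sq
      by (subst sum.swap, rule sum.cong[OF refl], subst sum.swap) (simp add: sum_distrib_left)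
    also have "\<dots> = (\<Sum>i\<in>I. \<Sum>j\<in>I. c i * cnj (c j) * ee (of_int a * (\<xi> i - \<xi> j)) *
        of_real (fejer M (\<xi> i - \<xi> j)))"
      by (intro sum.cong refl arg_cong2[where f = "(*)"])
         (simp add: Q_def fejer_def complex_norm_square sum_product sum.cartesian_product split_beta
            del: of_real_power)
    finally have eq: "complex_of_real (\<Sum>q\<in>Q. (cmod (S (h q)))\<^sup>2) = \<dots>" .
    have "(\<Sum>q\<in>Q. (cmod (S (h q)))\<^sup>2) = cmod (complex_of_real (\<Sum>q\<in>Q. (cmod (S (h q)))\<^sup>2))"
      by (simp only: norm_of_real) (simp add: sum_nonneg)
    also have "\<dots> \<le> (\<Sum>i\<in>I. \<Sum>j\<in>I. cmod (c i * cnj (c j) * ee (of_int a * (\<xi> i - \<xi> j)) *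
        of_real (fejer M (\<xi> i - \<xi> j))))"
      unfolding eq by (intro sum_norm_le order_refl norm_sum)
    also have "\<dots> = (\<Sum>i\<in>I. \<Sum>j\<in>I. cmod (c i) * cmod (c j) * fejer M (\<xi> i - \<xi> j))"
      by (simp add: norm_mult)
    finally show ?thesis .
  qed
  finally show ?thesis using assms(3) by (simp add: field_simps)
qed

lemma sum_inverse_squares_le: "(\<Sum>k\<in>{1..n}. 1 / (real k)\<^sup>2) \<le> 2"
proof -
  have "(\<Sum>k\<in>{1..n}. 1 / (real k)\<^sup>2) \<le> 2 - 1 / real n" if "n \<ge> 1"
    using that
  proof (induction n rule: dec_induct)
    case (step n)
    have "1 / (real (Suc n))\<^sup>2 \<le> 1 / (real n * real (Suc n))"
      using step by (intro divide_left_mono) (auto simp: power2_eq_square)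
    also have "\<dots> = 1 / real n - 1 / real (Suc n)" using step by (simp add: field_simps)
    finally show ?case using step.IH by simp
  qed auto
  then show ?thesis by (cases "n = 0") (auto intro: order_trans)
qed

text \<open>
  On either side of the nearest integer, each interval of length \<open>\<delta>\<close> contains at most one of the points
  \<open>\<theta> + \<xi>\<^sub>j\<close>, so the kernel bounds \<open>M\<^sup>2\<close> and \<open>1 / (4 d\<^sup>2)\<close> at distance \<open>d \<ge> k \<delta> \<ge> k / M\<close> give at most
  \<open>2 M\<^sup>2 (1 + \<Sum> 1 / (4 k\<^sup>2))\<close>.
\<close>

lemma sum_fejer_le:
  fixes \<xi> :: "'i \<Rightarrow> real"
  assumes fin: "finite J" and \<delta>: "\<delta> > 0" and M: "real M * \<delta> \<ge> 1"
    and sp: "\<And>i j. i \<in> J \<Longrightarrow> j \<in> J \<Longrightarrow> i \<noteq> j \<Longrightarrow> dist_int (\<xi> i - \<xi> j) \<ge> \<delta>"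
  shows "(\<Sum>j\<in>J. fejer M (\<theta> + \<xi> j)) \<le> 3 * (real M)\<^sup>2"
proof -
  define s where "s j = \<theta> + \<xi> j - of_int (round (\<theta> + \<xi> j))" for j
  define b where "b j = nat \<lfloor>\<bar>s j\<bar> / \<delta>\<rfloor>" for j
  define w where "w k = (if k = 0 then 1 else 1 / (4 * (real k)\<^sup>2))" for k :: nat
  define m where "m = Max (insert 0 (b ` J))"
  have fw: "fejer M (\<theta> + \<xi> j) \<le> (real M)\<^sup>2 * w (b j)" for j
  proof (cases "b j = 0")
    case True
    then show ?thesis by (simp add: w_def fejer_le)
  next
    case False
    have "real (b j) \<le> \<bar>s j\<bar> / \<delta>" using \<delta> by (simp add: b_def)
    then have bs: "real (b j) * \<delta> \<le> \<bar>s j\<bar>" using \<delta> by (simp add: field_simps)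
    have d: "dist_int (\<theta> + \<xi> j) = \<bar>s j\<bar>" by (simp add: s_def dist_int_eq_round)
    have pos: "0 < real (b j) * \<delta>" using False \<delta> by simp
    have "fejer M (\<theta> + \<xi> j) \<le> 1 / (4 * \<bar>s j\<bar>\<^sup>2)"
      using fejer_le_dist[of "\<theta> + \<xi> j" M] pos bs unfolding d by linarith
    also have "\<dots> \<le> 1 / (4 * (real (b j) * \<delta>)\<^sup>2)"
    proof (intro divide_left_mono mult_left_mono power_mono bs)
      have "s j \<noteq> 0" using pos bs by auto
      then show "0 < 4 * \<bar>s j\<bar>\<^sup>2 * (4 * (real (b j) * \<delta>)\<^sup>2)"
        using False \<delta> by (intro mult_pos_pos zero_less_power) auto
    qed (use pos in auto)
    also have "\<dots> = 1 / (4 * (real (b j))\<^sup>2) * (1 / \<delta>)\<^sup>2"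
      using \<delta> by (simp add: power_mult_distrib power_divide)
    also have "\<dots> \<le> 1 / (4 * (real (b j))\<^sup>2) * (real M)\<^sup>2"
      using \<delta> M by (intro mult_left_mono power_mono) (auto simp: field_simps)
    finally show ?thesis using False by (simp add: w_def mult.commute)
  qed
  have inj: "inj_on (\<lambda>j. (b j, s j \<ge> 0)) J"
  proof (rule inj_onI, rule ccontr)
    fix i j assume ij: "i \<in> J" "j \<in> J" "(b i, s i \<ge> 0) = (b j, s j \<ge> 0)" "i \<noteq> j"
    have "\<lfloor>\<bar>s i\<bar> / \<delta>\<rfloor> = \<lfloor>\<bar>s j\<bar> / \<delta>\<rfloor>"
      using ij(3) \<delta> by (simp add: b_def eq_nat_nat_iff)
    then have "\<bar>\<bar>s i\<bar> / \<delta> - \<bar>s j\<bar> / \<delta>\<bar> < 1" by linarith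
    then have "\<bar>\<bar>s i\<bar> - \<bar>s j\<bar>\<bar> < \<delta>" using \<delta> by (simp flip: diff_divide_distrib)
    then have "\<bar>s i - s j\<bar> < \<delta>" using ij(3) by (auto simp: abs_if split: if_splits)
    moreover have "dist_int (\<xi> i - \<xi> j) \<le> \<bar>\<xi> i - \<xi> j - of_int (round (\<theta> + \<xi> i) - round (\<theta> + \<xi> j))\<bar>"
      by (rule dist_int_eq_min(2))
    moreover have "\<xi> i - \<xi> j - of_int (round (\<theta> + \<xi> i) - round (\<theta> + \<xi> j)) = s i - s j"
      by (simp add: s_def)
    ultimately show False using sp[OF ij(1,2,4)] by simp
  qed
  have "(\<Sum>j\<in>J. fejer M (\<theta> + \<xi> j)) \<le> (\<Sum>j\<in>J. (real M)\<^sup>2 * w (b j))"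
    by (intro sum_mono fw)
  also have "\<dots> = (real M)\<^sup>2 * (\<Sum>q\<in>(\<lambda>j. (b j, s j \<ge> 0)) ` J. w (fst q))"
    by (subst sum.reindex[OF inj]) (simp add: sum_distrib_left)
  also have "(\<Sum>q\<in>(\<lambda>j. (b j, s j \<ge> 0)) ` J. w (fst q)) \<le> (\<Sum>q\<in>{..m} \<times> (UNIV :: bool set). w (fst q))"
    using fin by (intro sum_mono2) (auto simp: m_def w_def)
  also have "\<dots> = 2 * (\<Sum>k\<le>m. w k)"
    using sum.cartesian_product[of "\<lambda>k _. w k" "UNIV :: bool set" "{..m}"]
    by (simp add: split_beta sum_distrib_left)
  also have "(\<Sum>k\<le>m. w k) = 1 + (\<Sum>k\<in>{1..m}. 1 / (real k)\<^sup>2) / 4"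
  proof -
    have "{..m} = insert 0 {1..m}" by auto
    then show ?thesis by (simp add: w_def sum_divide_distrib mult.commute)
  qed
  finally have "(\<Sum>j\<in>J. fejer M (\<theta> + \<xi> j)) \<le> (real M)\<^sup>2 * (2 * (1 + (\<Sum>k\<in>{1..m}. 1 / (real k)\<^sup>2) / 4))"
    by (simp add: mult_left_mono)
  also have "\<dots> \<le> (real M)\<^sup>2 * 3"
    using sum_inverse_squares_le[of m] by (intro mult_left_mono) auto
  finally show ?thesis by (simp add: mult.commute)
qed

text \<open>
  Schur's test for a symmetric nonnegative kernel.
\<close>

lemma quadratic_form_le:
  fixes a :: "'i \<Rightarrow> real"
  assumes sym: "\<And>i j. k i j = k j i" and nn: "\<And>i j. k i j \<ge> 0"
    and row: "\<And>i. i \<in> I \<Longrightarrow> (\<Sum>j\<in>I. k i j) \<le> B"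
  shows "(\<Sum>i\<in>I. \<Sum>j\<in>I. a i * a j * k i j) \<le> B * (\<Sum>i\<in>I. (a i)\<^sup>2)"
proof -
  have "(\<Sum>i\<in>I. \<Sum>j\<in>I. a i * a j * k i j) \<le> (\<Sum>i\<in>I. \<Sum>j\<in>I. (a i)\<^sup>2 * k i j / 2 + (a j)\<^sup>2 * k j i / 2)"
  proof (intro sum_mono)
    fix i j
    have "a i * a j \<le> ((a i)\<^sup>2 + (a j)\<^sup>2) / 2"
      using zero_le_power2[of "a i - a j"] by (simp add: power2_diff)
    then have "a i * a j * k i j \<le> ((a i)\<^sup>2 + (a j)\<^sup>2) / 2 * k i j"
      by (intro mult_right_mono nn)
    then show "a i * a j * k i j \<le> (a i)\<^sup>2 * k i j / 2 + (a j)\<^sup>2 * k j i / 2"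
      by (simp add: sym[of j i] algebra_simps add_divide_distrib)
  qed
  also have "\<dots> = (\<Sum>i\<in>I. \<Sum>j\<in>I. (a i)\<^sup>2 * k i j)"
    by (simp only: sum.distrib) (subst (2) sum.swap, simp flip: sum_divide_distrib)
  also have "\<dots> = (\<Sum>i\<in>I. (a i)\<^sup>2 * (\<Sum>j\<in>I. k i j))" by (simp add: sum_distrib_left)
  also have "\<dots> \<le> (\<Sum>i\<in>I. (a i)\<^sup>2 * B)" by (intro sum_mono mult_left_mono row) auto
  finally show ?thesis by (simp add: sum_distrib_left mult.commute)
qed

text \<open>
  Apply the dual inequality to \<open>b = cnj T\<close>, where \<open>T\<close> is the inner sum on the left, and Cauchy's
  inequality to \<open>\<Sum> |T|\<^sup>2 = \<Sum> u(p) (\<Sum> cnj T(x) k(x,p))\<close>.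
\<close>

lemma duality:
  fixes k :: "'x \<Rightarrow> 'p \<Rightarrow> complex"
  assumes "finite X" "finite P" "B \<ge> 0"
    and dual: "\<And>b. (\<Sum>p\<in>P. (cmod (\<Sum>x\<in>X. b x * k x p))\<^sup>2) \<le> B * (\<Sum>x\<in>X. (cmod (b x))\<^sup>2)"
  shows "(\<Sum>x\<in>X. (cmod (\<Sum>p\<in>P. u p * k x p))\<^sup>2) \<le> B * (\<Sum>p\<in>P. (cmod (u p))\<^sup>2)"
proof -
  define T where "T x = (\<Sum>p\<in>P. u p * k x p)" for x
  define Z where "Z = (\<Sum>x\<in>X. (cmod (T x))\<^sup>2)"
  define U where "U = (\<Sum>p\<in>P. (cmod (u p))\<^sup>2)"
  define S where "S p = (\<Sum>x\<in>X. cnj (T x) * k x p)" for p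
  have Z0: "Z \<ge> 0" by (simp add: Z_def sum_nonneg)
  have U0: "U \<ge> 0" by (simp add: U_def sum_nonneg)
  have "complex_of_real Z = (\<Sum>x\<in>X. cnj (T x) * T x)"
    by (simp add: Z_def complex_norm_square mult.commute del: of_real_power)
  also have "\<dots> = (\<Sum>x\<in>X. \<Sum>p\<in>P. u p * (cnj (T x) * k x p))"
    by (subst (2) T_def) (simp add: sum_distrib_left mult_ac)
  also have "\<dots> = (\<Sum>p\<in>P. u p * S p)"
    by (subst sum.swap) (simp add: S_def sum_distrib_left)
  finally have "Z = cmod (\<Sum>p\<in>P. u p * S p)" using Z0 by (metis norm_of_real abs_of_nonneg)
  also have "\<dots> \<le> (\<Sum>p\<in>P. cmod (u p) * cmod (S p))"
    by (rule order_trans[OF norm_sum]) (simp add: norm_mult)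
  finally have "Z\<^sup>2 \<le> (\<Sum>p\<in>P. cmod (u p) * cmod (S p))\<^sup>2" using Z0 by (intro power_mono)
  also have "\<dots> \<le> U * (\<Sum>p\<in>P. (cmod (S p))\<^sup>2)"
    unfolding U_def by (rule Cauchy_Schwarz_ineq_sum)
  also have "U * (\<Sum>p\<in>P. (cmod (S p))\<^sup>2) \<le> U * (B * Z)"
    using dual[of "\<lambda>x. cnj (T x)"] U0 by (intro mult_left_mono) (simp_all add: S_def Z_def)
  finally have "Z * Z \<le> (B * U) * Z" by (simp add: power2_eq_square mult_ac)
  then have "Z \<le> B * U"
    using Z0 U0 assms(3) by (cases "Z = 0") (auto simp: mult_le_cancel_right)
  then show ?thesis by (simp add: Z_def U_def T_def)
qed

section \<open>The Selberg sieve as an exponential sum\<close>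

lemma dist_int_eq_0_iff: "dist_int t = 0 \<longleftrightarrow> t \<in> \<int>"
proof
  assume "dist_int t = 0"
  then have "t = of_int (round t)" by (simp add: dist_int_eq_round)
  then show "t \<in> \<int>" by (metis Ints_of_int)
qed (auto simp: dist_int_eq_round elim: Ints_cases)

lemma of_nat_div_of_nat_Ints_iff:
  "p > 0 \<Longrightarrow> real_of_int n / real p \<in> \<int> \<longleftrightarrow> int p dvd n"
proof
  assume p: "p > 0" and "real_of_int n / real p \<in> \<int>"
  then obtain k :: int where "real_of_int n / real p = of_int k" by (auto elim: Ints_cases)
  then have "real_of_int n = of_int (k * int p)" using p by (simp add: field_simps)
  then have "n = k * int p" by (simp only: of_int_eq_iff)
  then show "int p dvd n" by simp
qed (auto elim!: dvdE)

lemma sum_ee_nonzero_residues: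
  assumes p: "prime p" and n: "\<not> p dvd n"
  shows "(\<Sum>i\<in>{1..<p}. ee (real n * (real i / real p))) = -1"
proof -
  define w where "w = ee (real n / real p)"
  have p0: "p > 0" using p prime_gt_0_nat by blast
  have "real_of_int (int n) / real p \<notin> \<int>"
    using n p0 by (subst of_nat_div_of_nat_Ints_iff) (auto simp: int_dvd_int_iff)
  then have "dist_int (real n / real p) \<noteq> 0" by (simp add: dist_int_eq_0_iff)
  then have "cmod (1 - w) > 0"
    using norm_one_minus_ee_ge[of "real n / real p"] dist_int_nonneg[of "real n / real p"]
    unfolding w_def by linarith
  then have "w \<noteq> 1" by auto
  have "w ^ p = ee (of_int (int n))" using p0 by (simp add: w_def flip: ee_nat_mult)
  then have "(1 - w) * (\<Sum>i<p. w ^ i) = 0" by (simp only: one_diff_power_eq[symmetric] ee_of_int) simp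
  then have "(\<Sum>i<p. w ^ i) = 0" using \<open>w \<noteq> 1\<close> by simp
  moreover have "{..<p} = insert 0 {1..<p}" using p0 by auto
  ultimately have "(\<Sum>i\<in>{1..<p}. w ^ i) = -1" by (simp add: add_eq_0_iff)
  moreover have "ee (real n * (real i / real p)) = w ^ i" for i
    by (simp add: w_def mult.commute flip: ee_nat_mult)
  ultimately show ?thesis by simp
qed

text \<open>
  A vector \<open>a\<close> of residues \<open>a\<^sub>p < p\<close>, for \<open>p \<in> P\<close>, encodes the rational number \<open>freq a = \<Sum> a\<^sub>p / p\<close>
  modulo one, whose reduced denominator is the product of the support of \<open>a\<close>. Fractions of
  squarefree denominator at most \<open>R\<close> are thus handled through their partial fractions, on which
  the sieve coefficients are products. The sums over \<open>vecs\<close> and over \<open>supports\<close>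
  correspond to those over reduced fractions and over their denominators \<open>q\<close>, so that \<open>G\<close> is
  \<open>\<Sum> 1/\<phi>(q)\<close>, and \<open>coeff\<close> is Selberg's \<open>\<mu>(q) / (\<phi>(q) G)\<close>.
\<close>

locale sieve =
  fixes P :: "nat set" and R :: real
  assumes finite_P [simp, intro]: "finite P" and prime_P: "p \<in> P \<Longrightarrow> prime p" and R_ge: "R \<ge> 1"
begin

definition supp :: "(nat \<Rightarrow> nat) \<Rightarrow> nat set" where "supp a = {p \<in> P. a p \<noteq> 0}"
definition vecs :: "(nat \<Rightarrow> nat) set" where
  "vecs = {a \<in> PiE P (\<lambda>p. {..<p}). real (\<Prod>(supp a)) \<le> R}"
definition supports :: "nat set set" where "supports = {S. S \<subseteq> P \<and> real (\<Prod>S) \<le> R}"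
definition G :: real where "G = (\<Sum>S\<in>supports. \<Prod>p\<in>S. 1 / (real p - 1))"
definition freq :: "(nat \<Rightarrow> nat) \<Rightarrow> real" where "freq a = (\<Sum>p\<in>P. real (a p) / real p)"
definition weight :: "nat \<Rightarrow> nat \<Rightarrow> real" where "weight p i = (if i = 0 then 1 else - 1 / (real p - 1))"
definition coeff :: "(nat \<Rightarrow> nat) \<Rightarrow> real" where "coeff a = (\<Prod>p\<in>P. weight p (a p)) / G"

lemma P_ge_2: "p \<in> P \<Longrightarrow> real p \<ge> 2" using prime_P prime_ge_2_nat by force

lemma finite_supports [simp, intro]: "finite supports"
  by (rule finite_subset[of _ "Pow P"]) (auto simp: supports_def)

lemma finite_vecs [simp, intro]: "finite vecs"
  by (rule finite_subset[of _ "PiE P (\<lambda>p. {..<p})"]) (auto simp: vecs_def finite_PiE)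

lemma G_ge_1: "G \<ge> 1"
proof -
  have "(\<Sum>S\<in>{{}}. \<Prod>p\<in>S. 1 / (real p - 1)) \<le> G"
    unfolding G_def using P_ge_2 R_ge
    by (intro sum_mono2 prod_nonneg) (fastforce simp: supports_def)+
  then show ?thesis by simp
qed

text \<open>
  Sorting the vectors by support reduces sums of products over \<open>vecs\<close> to products of sums over
  nonzero residues. It gives both the value of \<open>\<Sum> coeff\<^sup>2\<close> and the sieve identity.
\<close>

lemma sum_vecs_prod:
  fixes h :: "nat \<Rightarrow> nat \<Rightarrow> 'b :: comm_semiring_1"
  assumes h0: "\<And>p. p \<in> P \<Longrightarrow> h p 0 = 1"
  shows "(\<Sum>a\<in>vecs. \<Prod>p\<in>P. h p (a p)) = (\<Sum>S\<in>supports. \<Prod>p\<in>S. \<Sum>i\<in>{1..<p}. h p i)"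
proof -
  define B where "B S p = (if p \<in> S then {1..<p} else {0})" for S and p :: nat
  have suppB: "supp a = S" if "a \<in> PiE P (B S)" "S \<subseteq> P" for a S
  proof -
    have "a p \<in> B S p" if "p \<in> P" for p using that \<open>a \<in> PiE P (B S)\<close> by (auto simp: PiE_def)
    then show ?thesis using \<open>S \<subseteq> P\<close> by (fastforce simp: supp_def B_def split: if_splits)
  qed
  have "vecs = (\<Union>S\<in>supports. PiE P (B S))"
  proof (intro equalityI subsetI)
    fix a assume a: "a \<in> vecs"
    then have "supp a \<in> supports" by (auto simp: vecs_def supports_def supp_def)
    moreover have "a \<in> PiE P (B (supp a))"
      using a by (auto simp: vecs_def B_def supp_def PiE_def Pi_def extensional_def)
    ultimately show "a \<in> (\<Union>S\<in>supports. PiE P (B S))" by blast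
  next
    fix a assume "a \<in> (\<Union>S\<in>supports. PiE P (B S))"
    then obtain S where S: "S \<in> supports" "a \<in> PiE P (B S)" by blast
    have "a p < p" if "p \<in> P" for p
    proof -
      have "a p \<in> B S p" using S that by (auto simp: PiE_def)
      then show ?thesis using prime_gt_0_nat[OF prime_P[OF that]] by (auto simp: B_def split: if_splits)
    qed
    then show "a \<in> vecs" using S suppB[OF S(2)] by (auto simp: vecs_def supports_def PiE_def)
  qed
  then have "(\<Sum>a\<in>vecs. \<Prod>p\<in>P. h p (a p)) = (\<Sum>S\<in>supports. \<Sum>a\<in>PiE P (B S). \<Prod>p\<in>P. h p (a p))"
  proof (simp only:, intro sum.UNION_disjoint ballI impI)
    show "finite (PiE P (B S))" for S by (intro finite_PiE) (auto simp: B_def)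
    show "PiE P (B S) \<inter> PiE P (B S') = {}" if "S \<in> supports" "S' \<in> supports" "S \<noteq> S'" for S S'
    proof -
      have "S \<subseteq> P" "S' \<subseteq> P" using that by (auto simp: supports_def)
      then show ?thesis using suppB that(3) by blast
    qed
  qed auto
  also have "\<dots> = (\<Sum>S\<in>supports. \<Prod>p\<in>S. \<Sum>i\<in>{1..<p}. h p i)"
  proof (intro sum.cong refl)
    fix S assume S: "S \<in> supports"
    have "(\<Sum>a\<in>PiE P (B S). \<Prod>p\<in>P. h p (a p)) = (\<Prod>p\<in>P. \<Sum>i\<in>B S p. h p i)"
      by (rule prod_sum_PiE[symmetric]) (auto simp: B_def)
    also have "\<dots> = (\<Prod>p\<in>P. if p \<in> S then \<Sum>i\<in>{1..<p}. h p i else 1)"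
      by (intro prod.cong refl) (auto simp: B_def h0)
    also have "\<dots> = (\<Prod>p\<in>S. \<Sum>i\<in>{1..<p}. h p i)"
      using S by (auto simp: supports_def prod.If_cases intro!: prod.cong)
    finally show "(\<Sum>a\<in>PiE P (B S). \<Prod>p\<in>P. h p (a p)) = (\<Prod>p\<in>S. \<Sum>i\<in>{1..<p}. h p i)" .
  qed
  finally show ?thesis .
qed

lemma sum_coeff_square: "(\<Sum>a\<in>vecs. (coeff a)\<^sup>2) = 1 / G"
proof -
  have "(\<Sum>a\<in>vecs. \<Prod>p\<in>P. (weight p (a p))\<^sup>2) = (\<Sum>S\<in>supports. \<Prod>p\<in>S. \<Sum>i\<in>{1..<p}. (weight p i)\<^sup>2)"
    by (rule sum_vecs_prod) (simp add: weight_def)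
  also have "\<dots> = G"
    unfolding G_def
  proof (intro sum.cong prod.cong refl)
    fix S p assume "S \<in> supports" "p \<in> S"
    then have "real p \<ge> 2" using P_ge_2 by (auto simp: supports_def)
    then show "(\<Sum>i\<in>{1..<p}. (weight p i)\<^sup>2) = 1 / (real p - 1)"
      by (simp add: weight_def power_divide power2_eq_square of_nat_diff)
  qed
  finally have "(\<Sum>a\<in>vecs. (coeff a)\<^sup>2) = G / G\<^sup>2"
    by (simp add: coeff_def power_divide prod_power_distrib flip: sum_divide_distrib)
  then show ?thesis using G_ge_1 by (simp add: power2_eq_square)
qed

text \<open>
  For \<open>n\<close> prime to \<open>P\<close> the Ramanujan sum of denominator \<open>q\<close> factors into sums over nonzero
  residues modulo \<open>p\<close>, each equal to \<open>-1\<close>. These signs cancel those of the coefficients.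
\<close>

lemma sum_coeff_ee:
  assumes "\<And>p. p \<in> P \<Longrightarrow> \<not> p dvd n"
  shows "(\<Sum>a\<in>vecs. of_real (coeff a) * ee (real n * freq a)) = 1"
proof -
  have "(\<Sum>a\<in>vecs. \<Prod>p\<in>P. of_real (weight p (a p)) * ee (real n * (real (a p) / real p)))
     = (\<Sum>S\<in>supports. \<Prod>p\<in>S. \<Sum>i\<in>{1..<p}. of_real (weight p i) * ee (real n * (real i / real p)))"
    by (rule sum_vecs_prod[of "\<lambda>p i. of_real (weight p i) * ee (real n * (real i / real p))"])
       (simp add: weight_def)
  also have "\<dots> = (\<Sum>S\<in>supports. \<Prod>p\<in>S. of_real (1 / (real p - 1)))"
  proof (intro sum.cong prod.cong refl)
    fix S p assume "S \<in> supports" "p \<in> S"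
    then have p: "p \<in> P" by (auto simp: supports_def)
    have "(\<Sum>i\<in>{1..<p}. of_real (weight p i) * ee (real n * (real i / real p)))
      = of_real (- 1 / (real p - 1)) * (\<Sum>i\<in>{1..<p}. ee (real n * (real i / real p)))"
      unfolding sum_distrib_left by (intro sum.cong refl) (auto simp: weight_def)
    also have "(\<Sum>i\<in>{1..<p}. ee (real n * (real i / real p))) = -1"
      using prime_P[OF p] assms[OF p] by (rule sum_ee_nonzero_residues)
    finally show "(\<Sum>i\<in>{1..<p}. of_real (weight p i) * ee (real n * (real i / real p)))
      = complex_of_real (1 / (real p - 1))" by simp
  qed
  also have "\<dots> = of_real G" by (simp only: G_def of_real_sum of_real_prod)
  finally have sumG: "(\<Sum>a\<in>vecs. \<Prod>p\<in>P. of_real (weight p (a p)) * ee (real n * (real (a p) / real p))) = of_real G" .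
  have "(\<Sum>a\<in>vecs. of_real (coeff a) * ee (real n * freq a)) =
    (\<Sum>a\<in>vecs. \<Prod>p\<in>P. of_real (weight p (a p)) * ee (real n * (real (a p) / real p))) / of_real G"
    unfolding sum_divide_distrib
    by (intro sum.cong refl) (simp add: coeff_def freq_def sum_distrib_left ee_sum prod.distrib)
  then show ?thesis using G_ge_1 unfolding sumG by simp
qed

text \<open>
  Uniqueness of the partial fraction expansion modulo the integers: multiply by the product of the
  primes other than \<open>q\<close>.
\<close>

lemma sum_fractions_Ints_imp_dvd:
  fixes c :: "nat \<Rightarrow> int"
  assumes int: "(\<Sum>p\<in>P. of_int (c p) / real p) \<in> \<int>" and q: "q \<in> P"
  shows "int q dvd c q"
proof -
  define Q where "Q = P - {q}"
  have q0: "q > 0" using prime_P[OF q] prime_gt_0_nat by blast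
  have frac_int: "of_int (c p) / real p * real (\<Prod>Q) \<in> \<int>" if "p \<in> Q" for p
  proof -
    have "real (\<Prod>Q) = real p * real (\<Prod>(Q - {p}))"
      using that by (subst prod.remove[of _ p]) (auto simp: Q_def)
    moreover have "p > 0" using that prime_P prime_gt_0_nat by (auto simp: Q_def)
    ultimately have "of_int (c p) / real p * real (\<Prod>Q) = of_int (c p * int (\<Prod>(Q - {p})))" by simp
    then show ?thesis by (metis Ints_of_int)
  qed
  have "(\<Sum>p\<in>P. of_int (c p) / real p) = of_int (c q) / real q + (\<Sum>p\<in>Q. of_int (c p) / real p)"
    using q by (simp add: Q_def sum.remove)
  then have "of_int (c q) / real q * real (\<Prod>Q) =
     (\<Sum>p\<in>P. of_int (c p) / real p) * real (\<Prod>Q) - (\<Sum>p\<in>Q. of_int (c p) / real p * real (\<Prod>Q))"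
    unfolding sum_distrib_right[symmetric] by (simp only: distrib_right add_diff_cancel_right')
  also have "\<dots> \<in> \<int>"
    by (rule Ints_diff[OF Ints_mult[OF int Ints_of_nat] Ints_sum[OF frac_int]])
  finally have "of_int (c q * int (\<Prod>Q)) / real q \<in> \<int>" by simp
  then have "int q dvd c q * int (\<Prod>Q)" using q0 by (simp only: of_nat_div_of_nat_Ints_iff)
  moreover have "coprime q (\<Prod>Q)"
    using prime_P q by (intro prod_coprime_right) (auto simp: Q_def primes_coprime)
  then have "coprime (int q) (int (\<Prod>Q))" by (simp only: coprime_int_iff)
  ultimately show ?thesis by (metis coprime_dvd_mult_left_iff)
qed

lemma freq_times_Ints: "freq a * real (\<Prod>(supp a)) \<in> \<int>"
proof -
  have "real (a p) / real p * real (\<Prod>(supp a)) \<in> \<int>" if "p \<in> P" for p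
  proof (cases "a p = 0")
    case False
    then have "real (\<Prod>(supp a)) = real p * real (\<Prod>(supp a - {p}))"
      using that by (subst prod.remove[of _ p]) (auto simp: supp_def)
    moreover have "p > 0" using that prime_P prime_gt_0_nat by auto
    ultimately have "real (a p) / real p * real (\<Prod>(supp a)) = real (a p * \<Prod>(supp a - {p}))" by simp
    then show ?thesis by (metis Ints_of_nat)
  qed simp
  then show ?thesis unfolding freq_def sum_distrib_right by (intro Ints_sum) auto
qed

lemma vecs_less: "a \<in> vecs \<Longrightarrow> p \<in> P \<Longrightarrow> a p < p"
  by (auto simp: vecs_def PiE_def)

lemma dvd_of_diff_Ints:
  assumes "freq a - freq b - (freq a' - freq b') \<in> \<int>" "p \<in> P"
  shows "int p dvd (int (a p) - int (b p)) - (int (a' p) - int (b' p))"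
proof (rule sum_fractions_Ints_imp_dvd[OF _ assms(2)])
  have "(\<Sum>p\<in>P. of_int (int (a p) - int (b p) - (int (a' p) - int (b' p))) / real p)
    = freq a - freq b - (freq a' - freq b')"
    by (simp add: freq_def diff_divide_distrib sum_subtractf)
  then show "(\<Sum>p\<in>P. of_int (int (a p) - int (b p) - (int (a' p) - int (b' p))) / real p) \<in> \<int>"
    using assms(1) by simp
qed

lemma eq_of_dvd_diff: "int p dvd int i - int j \<Longrightarrow> i < p \<Longrightarrow> j < p \<Longrightarrow> i = j"
  by (metis mod_eq_dvd_iff mod_less of_nat_eq_iff of_nat_mod)

lemma vecs_eqI:
  assumes "a \<in> vecs" "b \<in> vecs" "freq a - freq b \<in> \<int>"
  shows "a = b"
proof (rule PiE_ext)
  show "a \<in> PiE P (\<lambda>p. {..<p})" "b \<in> PiE P (\<lambda>p. {..<p})" using assms by (auto simp: vecs_def)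
  fix p assume "p \<in> P"
  then have "int p dvd int (a p) - int (b p)"
    using dvd_of_diff_Ints[of a b a a p] assms(3) by simp
  then show "a p = b p" using eq_of_dvd_diff vecs_less assms \<open>p \<in> P\<close> by blast
qed

text \<open>
  The representative in \<open>[0, 1)\<close> makes equality of shifts the same as congruence modulo one.
\<close>

definition shift :: "(nat \<Rightarrow> nat) \<times> (nat \<Rightarrow> nat) \<Rightarrow> real" where
  "shift ab = frac (freq (fst ab) - freq (snd ab))"

lemma shift_eq_iff: "shift ab = shift cd \<longleftrightarrow> freq (fst ab) - freq (snd ab) - (freq (fst cd) - freq (snd cd)) \<in> \<int>"
proof
  assume "shift ab = shift cd"
  then have "freq (fst ab) - freq (snd ab) - (freq (fst cd) - freq (snd cd)) =
    of_int (\<lfloor>freq (fst ab) - freq (snd ab)\<rfloor> - \<lfloor>freq (fst cd) - freq (snd cd)\<rfloor>)"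
    by (simp add: shift_def frac_def)
  then show "freq (fst ab) - freq (snd ab) - (freq (fst cd) - freq (snd cd)) \<in> \<int>" by (metis Ints_of_int)
next
  assume "freq (fst ab) - freq (snd ab) - (freq (fst cd) - freq (snd cd)) \<in> \<int>"
  then obtain k :: int where "freq (fst ab) - freq (snd ab) = freq (fst cd) - freq (snd cd) + of_int k"
    by (metis Ints_cases add.commute diff_add_cancel)
  then show "shift ab = shift cd" by (simp add: shift_def frac_def)
qed

text \<open>
  A difference of two shifts has a denominator dividing the product of four denominators, each at most \<open>R\<close>.
\<close>

lemma shift_spaced:
  assumes "ab \<in> vecs \<times> vecs" "cd \<in> vecs \<times> vecs" "shift ab \<noteq> shift cd"
  shows "dist_int (shift ab - shift cd) \<ge> 1 / R ^ 4"
proof -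
  define D where "D = real (\<Prod>(supp (fst ab))) * real (\<Prod>(supp (snd ab))) *
    (real (\<Prod>(supp (fst cd))) * real (\<Prod>(supp (snd cd))))"
  define t where "t = freq (fst ab) - freq (snd ab) - (freq (fst cd) - freq (snd cd))"
  have pos: "real (\<Prod>(supp a)) > 0" for a
    using prime_P prime_gt_0_nat by (auto simp: supp_def intro!: prod_pos)
  have le: "real (\<Prod>(supp a)) \<le> R" if "a \<in> vecs" for a using that by (simp add: vecs_def)
  have D0: "D > 0" unfolding D_def by (intro mult_pos_pos pos)
  have "D \<le> R * R * (R * R)"
    unfolding D_def using assms R_ge by (intro mult_mono le mult_nonneg_nonneg less_imp_le[OF pos]) auto
  then have DR: "D \<le> R ^ 4" by (simp add: power4_eq_xxxx mult.assoc)
  have i: "freq a * real (\<Prod>(supp a)) * m \<in> \<int>" if "m \<in> \<int>" for a m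
    using that by (intro Ints_mult freq_times_Ints)
  have tD: "t * D \<in> \<int>"
  proof -
    have "t * D =
      freq (fst ab) * real (\<Prod>(supp (fst ab))) * (real (\<Prod>(supp (snd ab))) * (real (\<Prod>(supp (fst cd))) * real (\<Prod>(supp (snd cd)))))
      - freq (snd ab) * real (\<Prod>(supp (snd ab))) * (real (\<Prod>(supp (fst ab))) * (real (\<Prod>(supp (fst cd))) * real (\<Prod>(supp (snd cd)))))
      - (freq (fst cd) * real (\<Prod>(supp (fst cd))) * (real (\<Prod>(supp (fst ab))) * (real (\<Prod>(supp (snd ab))) * real (\<Prod>(supp (snd cd)))))
      - freq (snd cd) * real (\<Prod>(supp (snd cd))) * (real (\<Prod>(supp (fst ab))) * (real (\<Prod>(supp (snd ab))) * real (\<Prod>(supp (fst cd))))))"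
      unfolding t_def D_def by (simp add: algebra_simps)
    also have "\<dots> \<in> \<int>" by (intro Ints_diff i Ints_mult Ints_of_nat)
    finally show ?thesis .
  qed
  obtain k :: int where k: "dist_int (shift ab - shift cd) = \<bar>shift ab - shift cd - of_int k\<bar>"
    using dist_int_eq_min(1) by blast
  define l where "l = \<lfloor>freq (fst ab) - freq (snd ab)\<rfloor> - \<lfloor>freq (fst cd) - freq (snd cd)\<rfloor> + k"
  have w: "shift ab - shift cd - of_int k = t - of_int l"
    by (simp add: shift_def frac_def t_def l_def)
  have "t \<notin> \<int>" using assms(3) by (simp add: shift_eq_iff t_def)
  then have "t - of_int l \<noteq> 0" by auto
  moreover have "D \<in> \<int>" unfolding D_def by (intro Ints_mult Ints_of_nat)
  then have "(t - of_int l) * D \<in> \<int>"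
    unfolding left_diff_distrib by (intro Ints_diff tD Ints_mult) auto
  ultimately have "\<bar>(t - of_int l) * D\<bar> \<ge> 1"
    using D0 by (intro Ints_nonzero_abs_ge1) auto
  then have "\<bar>t - of_int l\<bar> * D \<ge> 1" using D0 by (simp add: abs_mult)
  then have "1 / D \<le> \<bar>t - of_int l\<bar>" using D0 by (simp add: field_simps)
  moreover have "1 / R ^ 4 \<le> 1 / D" using DR D0 by (intro divide_left_mono mult_pos_pos) auto
  ultimately show ?thesis by (simp add: k w)
qed

text \<open>
  Deleting the \<open>p\<close>-component of a vector multiplies its coefficient by \<open>1 - p\<close> and stays inside \<open>vecs\<close>.
\<close>

lemma sum_coeff_square_fixed_residue:
  assumes p: "p \<in> P" and e: "e \<noteq> 0"
  shows "(\<Sum>a\<in>{a \<in> vecs. a p = e}. (coeff a)\<^sup>2) \<le> 1 / ((real p - 1)\<^sup>2 * G)"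
proof -
  have fa: "coeff a = - 1 / (real p - 1) * coeff (a(p := 0))" if "a p = e" for a
  proof -
    have "(\<Prod>q\<in>P. weight q (a q)) = weight p e * (\<Prod>q\<in>P - {p}. weight q (a q))"
      using p that by (simp add: prod.remove)
    moreover have "(\<Prod>q\<in>P. weight q ((a(p := 0)) q)) = (\<Prod>q\<in>P - {p}. weight q (a q))"
      using p by (subst prod.remove[of _ p]) (auto simp: weight_def intro!: prod.cong)
    ultimately show ?thesis using e by (simp add: coeff_def weight_def)
  qed
  have sub: "(\<lambda>a. a(p := 0)) ` {a \<in> vecs. a p = e} \<subseteq> vecs"
  proof
    fix b assume "b \<in> (\<lambda>a. a(p := 0)) ` {a \<in> vecs. a p = e}"
    then obtain a where a: "a \<in> vecs" "a p = e" "b = a(p := 0)" by auto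
    have "supp a = insert p (supp b)" "p \<notin> supp b" using a p e by (auto simp: supp_def)
    then have "\<Prod>(supp a) = p * \<Prod>(supp b)" by (simp add: supp_def)
    then have "\<Prod>(supp b) \<le> \<Prod>(supp a)" using prime_gt_0_nat[OF prime_P[OF p]] by simp
    then have "real (\<Prod>(supp b)) \<le> R" using a(1) of_nat_mono[of "\<Prod>(supp b)" "\<Prod>(supp a)", where 'a = real]
      by (simp add: vecs_def del: of_nat_prod)
    moreover have "b \<in> PiE P (\<lambda>p. {..<p})"
      using a p prime_gt_0_nat[OF prime_P[OF p]] by (auto simp: vecs_def PiE_def extensional_def)
    ultimately show "b \<in> vecs" by (simp add: vecs_def)
  qed
  have inj: "inj_on (\<lambda>a. a(p := 0)) {a \<in> vecs. a p = e}"
  proof (rule inj_onI)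
    fix a b assume ab: "a \<in> {a \<in> vecs. a p = e}" "b \<in> {a \<in> vecs. a p = e}" "a(p := 0) = b(p := 0)"
    have "a = (a(p := 0))(p := e)" "b = (b(p := 0))(p := e)" using ab(1,2) by auto
    then show "a = b" using ab(3) by simp
  qed
  have "(\<Sum>a\<in>{a \<in> vecs. a p = e}. (coeff a)\<^sup>2) = (\<Sum>a\<in>{a \<in> vecs. a p = e}. (coeff (a(p := 0)))\<^sup>2) / (real p - 1)\<^sup>2"
    unfolding sum_divide_distrib by (intro sum.cong refl) (simp add: fa power_divide)
  also have "(\<Sum>a\<in>{a \<in> vecs. a p = e}. (coeff (a(p := 0)))\<^sup>2) = (\<Sum>a\<in>(\<lambda>a. a(p := 0)) ` {a \<in> vecs. a p = e}. (coeff a)\<^sup>2)"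
    by (subst sum.reindex[OF inj]) simp
  also have "\<dots> / (real p - 1)\<^sup>2 \<le> (\<Sum>a\<in>vecs. (coeff a)\<^sup>2) / (real p - 1)\<^sup>2"
    using sub by (intro divide_right_mono sum_mono2) auto
  also have "\<dots> = 1 / ((real p - 1)\<^sup>2 * G)" by (simp add: sum_coeff_square)
  finally show ?thesis .
qed

lemma sum_coeff_square_nonzero_residue:
  assumes p: "p \<in> P"
  shows "(\<Sum>a\<in>{a \<in> vecs. a p \<noteq> 0}. (coeff a)\<^sup>2) \<le> 1 / ((real p - 1) * G)"
proof -
  have "{a \<in> vecs. a p \<noteq> 0} = (\<Union>e\<in>{1..<p}. {a \<in> vecs. a p = e})"
    using vecs_less[OF _ p] by (auto simp: Suc_le_eq)
  then have "(\<Sum>a\<in>{a \<in> vecs. a p \<noteq> 0}. (coeff a)\<^sup>2) = (\<Sum>e\<in>{1..<p}. \<Sum>a\<in>{a \<in> vecs. a p = e}. (coeff a)\<^sup>2)"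
    by (simp only:) (intro sum.UNION_disjoint, auto)
  also have "\<dots> \<le> (\<Sum>e\<in>{1..<p}. 1 / ((real p - 1)\<^sup>2 * G))"
    by (intro sum_mono sum_coeff_square_fixed_residue p) auto
  also have "\<dots> = 1 / ((real p - 1) * G)"
    using P_ge_2[OF p] by (simp add: of_nat_diff power2_eq_square)
  finally show ?thesis .
qed

text \<open>
  The weighted inequality between arithmetic and geometric means balances the two sides: the first
  components have total square mass \<open>1 / ((p - 1)\<^sup>2 G)\<close> only, the second ones at most \<open>1 / G\<close>.
\<close>

lemma sum_pairs_fst_residue_le:
  assumes p: "p \<in> P" and e: "e \<noteq> 0" and C: "C \<subseteq> vecs \<times> vecs" "inj_on fst C" "inj_on snd C"
    and res: "\<And>ab. ab \<in> C \<Longrightarrow> fst ab p = e"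
  shows "(\<Sum>ab\<in>C. \<bar>coeff (fst ab)\<bar> * \<bar>coeff (snd ab)\<bar>) \<le> 1 / ((real p - 1) * G)"
proof -
  define r where "r = real p - 1"
  have r: "r > 0" using P_ge_2[OF p] by (simp add: r_def)
  have "(\<Sum>ab\<in>C. \<bar>coeff (fst ab)\<bar> * \<bar>coeff (snd ab)\<bar>)
     \<le> (\<Sum>ab\<in>C. r / 2 * (coeff (fst ab))\<^sup>2 + 1 / (2 * r) * (coeff (snd ab))\<^sup>2)"
  proof (intro sum_mono)
    fix ab
    have "0 \<le> (r * \<bar>coeff (fst ab)\<bar> - \<bar>coeff (snd ab)\<bar>)\<^sup>2" by simp
    then have "2 * r * (\<bar>coeff (fst ab)\<bar> * \<bar>coeff (snd ab)\<bar>) \<le> r\<^sup>2 * (coeff (fst ab))\<^sup>2 + (coeff (snd ab))\<^sup>2"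
      by (simp add: power2_diff power_mult_distrib)
    then show "\<bar>coeff (fst ab)\<bar> * \<bar>coeff (snd ab)\<bar> \<le> r / 2 * (coeff (fst ab))\<^sup>2 + 1 / (2 * r) * (coeff (snd ab))\<^sup>2"
      using r by (simp add: field_simps power2_eq_square)
  qed
  also have "\<dots> = r / 2 * (\<Sum>a\<in>fst ` C. (coeff a)\<^sup>2) + 1 / (2 * r) * (\<Sum>a\<in>snd ` C. (coeff a)\<^sup>2)"
    by (simp add: sum.distrib sum_distrib_left sum.reindex C)
  also have "\<dots> \<le> r / 2 * (\<Sum>a\<in>{a \<in> vecs. a p = e}. (coeff a)\<^sup>2) + 1 / (2 * r) * (\<Sum>a\<in>vecs. (coeff a)\<^sup>2)"
    using r C(1) res by (intro add_mono mult_left_mono sum_mono2) auto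
  also have "\<dots> \<le> r / 2 * (1 / (r\<^sup>2 * G)) + 1 / (2 * r) * (1 / G)"
    using r sum_coeff_square_fixed_residue[OF p e]
    by (intro add_mono mult_left_mono) (auto simp: sum_coeff_square r_def)
  also have "\<dots> = 1 / (r * G)" using r by (simp add: power2_eq_square)
  finally show ?thesis by (simp add: r_def)
qed

text \<open>
  All pairs with the same shift \<open>t\<close> have the same difference of residues at every prime, and for \<open>t \<noteq> 0\<close>
  this difference is nonzero at some prime \<open>p\<close>. Either component determines the other. If one of the
  two residues at \<open>p\<close> vanishes, the other one is prescribed, and if neither vanishes, both
  vectors lie in the part of square mass at most \<open>1 / ((p - 1) G)\<close>. Each of these three cases
  contributes at most \<open>1 / ((p - 1) G)\<close>.
\<close>

lemma sum_pairs_shift_le: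
  assumes z: "z > 0" "\<And>p. p \<in> P \<Longrightarrow> z \<le> real p - 1" and t: "t \<noteq> 0"
  shows "(\<Sum>ab\<in>{ab \<in> vecs \<times> vecs. shift ab = t}. \<bar>coeff (fst ab)\<bar> * \<bar>coeff (snd ab)\<bar>) \<le> 3 / (z * G)"
proof (cases "{ab \<in> vecs \<times> vecs. shift ab = t} = {}")
  case True
  show ?thesis unfolding True using z G_ge_1 by simp
next
  case False
  define C where "C = {ab \<in> vecs \<times> vecs. shift ab = t}"
  have finC: "finite C" by (simp add: C_def)
  have sub: "C \<subseteq> vecs \<times> vecs" by (auto simp: C_def)
  have diff: "freq (fst ab) - freq (snd ab) - (freq (fst cd) - freq (snd cd)) \<in> \<int>" if "ab \<in> C" "cd \<in> C" for ab cd
    using that by (auto simp: C_def simp flip: shift_eq_iff)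
  have inj1: "inj_on fst C"
  proof (rule inj_onI)
    fix ab cd assume *: "ab \<in> C" "cd \<in> C" "fst ab = fst cd"
    then have "freq (snd cd) - freq (snd ab) \<in> \<int>" using diff[OF *(1,2)] by simp
    then have "snd cd = snd ab"
      using subsetD[OF sub *(1)] subsetD[OF sub *(2)] by (intro vecs_eqI) (auto simp: mem_Times_iff)
    then show "ab = cd" using * by (simp add: prod_eq_iff)
  qed
  have inj2: "inj_on snd C"
  proof (rule inj_onI)
    fix ab cd assume *: "ab \<in> C" "cd \<in> C" "snd ab = snd cd"
    then have "freq (fst ab) - freq (fst cd) \<in> \<int>" using diff[OF *(1,2)] by simp
    then have "fst ab = fst cd"
      using subsetD[OF sub *(1)] subsetD[OF sub *(2)] by (intro vecs_eqI) (auto simp: mem_Times_iff)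
    then show "ab = cd" using * by (simp add: prod_eq_iff)
  qed
  from False obtain ab0 where ab0: "ab0 \<in> C" unfolding C_def by blast
  have "fst ab0 \<noteq> snd ab0" using ab0 t by (auto simp: C_def shift_def)
  moreover have "fst ab0 \<in> PiE P (\<lambda>p. {..<p})" "snd ab0 \<in> PiE P (\<lambda>p. {..<p})"
    using subsetD[OF sub ab0] by (auto simp: vecs_def mem_Times_iff)
  ultimately obtain p where p: "p \<in> P" "fst ab0 p \<noteq> snd ab0 p"
    using PiE_ext[of "fst ab0" P "\<lambda>p. {..<p}" "snd ab0"] by blast
  have res: "int p dvd (int (fst ab p) - int (snd ab p)) - (int (fst cd p) - int (snd cd p))"
    if "ab \<in> C" "cd \<in> C" for ab cd
    using diff[OF that] p(1) by (rule dvd_of_diff_Ints)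
  have less: "fst ab p < p" "snd ab p < p" if "ab \<in> C" for ab
    using that sub p vecs_less by (auto simp: mem_Times_iff)
  have ne: "fst ab p \<noteq> snd ab p" if "ab \<in> C" for ab
    using res[OF ab0 that] p(2) less[OF ab0] eq_of_dvd_diff[of p "fst ab0 p" "snd ab0 p"] by auto
  define C1 where "C1 = {ab \<in> C. snd ab p = 0}"
  define C2 where "C2 = {ab \<in> C. fst ab p = 0}"
  define C3 where "C3 = {ab \<in> C. fst ab p \<noteq> 0 \<and> snd ab p \<noteq> 0}"
  let ?F = "\<lambda>ab. \<bar>coeff (fst ab)\<bar> * \<bar>coeff (snd ab)\<bar>"
  have b1: "sum ?F C1 \<le> 1 / ((real p - 1) * G)"
  proof (cases "C1 = {}")
    case True
    then show ?thesis using P_ge_2[OF p(1)] G_ge_1 by simp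
  next
    case False
    then obtain cd where cd: "cd \<in> C1" by blast
    show ?thesis
    proof (rule sum_pairs_fst_residue_le[OF p(1), of "fst cd p"])
      show "fst cd p \<noteq> 0" using ne[of cd] cd by (auto simp: C1_def)
      show "C1 \<subseteq> vecs \<times> vecs" "inj_on fst C1" "inj_on snd C1"
        using sub inj1 inj2 by (auto simp: C1_def inj_on_def)
      show "fst ab p = fst cd p" if "ab \<in> C1" for ab
        using that cd res[of ab cd] less by (intro eq_of_dvd_diff[of p]) (auto simp: C1_def)
    qed
  qed
  have b2: "sum ?F C2 \<le> 1 / ((real p - 1) * G)"
  proof (cases "C2 = {}")
    case True
    then show ?thesis using P_ge_2[OF p(1)] G_ge_1 by simp
  next
    case False
    then obtain cd where cd: "cd \<in> C2" by blast
    have "sum ?F C2 = sum ?F (prod.swap ` C2)"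
      by (subst sum.reindex) (auto simp: inj_on_def mult.commute)
    also have "\<dots> \<le> 1 / ((real p - 1) * G)"
    proof (rule sum_pairs_fst_residue_le[OF p(1), of "snd cd p"])
      show "snd cd p \<noteq> 0" using ne[of cd] cd by (auto simp: C2_def)
      show "prod.swap ` C2 \<subseteq> vecs \<times> vecs" using sub by (auto simp: C2_def)
      have "inj_on (fst \<circ> prod.swap) C2" "inj_on (snd \<circ> prod.swap) C2"
        using inj_on_subset[OF inj1, of C2] inj_on_subset[OF inj2, of C2] by (auto simp: C2_def o_def)
      then show "inj_on fst (prod.swap ` C2)" "inj_on snd (prod.swap ` C2)"
        by (auto intro: inj_on_imageI)
      show "fst ba p = snd cd p" if "ba \<in> prod.swap ` C2" for ba
      proof -
        from that obtain ab where ab: "ab \<in> C2" "ba = prod.swap ab" by blast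
        have "int p dvd int (snd ab p) - int (snd cd p)"
          using ab cd res[of cd ab] by (simp add: C2_def)
        then show ?thesis using ab cd less by (intro eq_of_dvd_diff[of p]) (auto simp: C2_def)
      qed
    qed
    finally show ?thesis .
  qed
  have b3: "sum ?F C3 \<le> 1 / ((real p - 1) * G)"
  proof -
    have "sum ?F C3 \<le> (\<Sum>ab\<in>C3. (coeff (fst ab))\<^sup>2 / 2 + (coeff (snd ab))\<^sup>2 / 2)"
    proof (intro sum_mono)
      fix ab
      have "0 \<le> (\<bar>coeff (fst ab)\<bar> - \<bar>coeff (snd ab)\<bar>)\<^sup>2" by simp
      then show "?F ab \<le> (coeff (fst ab))\<^sup>2 / 2 + (coeff (snd ab))\<^sup>2 / 2" by (simp add: power2_diff)
    qed
    also have "\<dots> = (\<Sum>a\<in>fst ` C3. (coeff a)\<^sup>2) / 2 + (\<Sum>a\<in>snd ` C3. (coeff a)\<^sup>2) / 2"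
    proof -
      have "inj_on fst C3" "inj_on snd C3" using inj1 inj2 by (auto simp: C3_def inj_on_def)
      then show ?thesis by (simp add: sum.distrib sum.reindex sum_divide_distrib)
    qed
    also have "\<dots> \<le> (\<Sum>a\<in>{a \<in> vecs. a p \<noteq> 0}. (coeff a)\<^sup>2) / 2 + (\<Sum>a\<in>{a \<in> vecs. a p \<noteq> 0}. (coeff a)\<^sup>2) / 2"
      using sub by (intro add_mono divide_right_mono sum_mono2) (auto simp: C3_def)
    also have "\<dots> \<le> 1 / ((real p - 1) * G)" using sum_coeff_square_nonzero_residue[OF p(1)] by simp
    finally show ?thesis .
  qed
  have "sum ?F C = sum ?F (C1 \<union> C2 \<union> C3)"
    by (rule sum.cong) (auto simp: C1_def C2_def C3_def)
  also have "\<dots> = (sum ?F (C1 \<union> C2)) + sum ?F C3"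
    using finC by (intro sum.union_disjoint) (auto simp: C1_def C2_def C3_def)
  also have "sum ?F (C1 \<union> C2) = sum ?F C1 + sum ?F C2"
  proof (intro sum.union_disjoint)
    have False if "ab \<in> C1" "ab \<in> C2" for ab
      using that ne[of ab] by (simp add: C1_def C2_def)
    then show "C1 \<inter> C2 = {}" by blast
  qed (use finC in \<open>auto simp: C1_def C2_def\<close>)
  also have "sum ?F C1 + sum ?F C2 + sum ?F C3 \<le> 3 / ((real p - 1) * G)"
    using b1 b2 b3 by linarith
  also have "\<dots> \<le> 3 / (z * G)"
    using z(1) z(2)[OF p(1)] G_ge_1 P_ge_2[OF p(1)] by (intro divide_left_mono mult_right_mono) auto
  finally show ?thesis by (simp add: C_def)
qed

text \<open>
  Grouping the pairs by their shift \<open>t\<close> separates the diagonal \<open>t = 0\<close> from the other shifts, which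
  carry small weights and are spaced widely enough for \<open>sum_fejer_le\<close>.
\<close>

lemma sieve_kernel_le:
  assumes z: "z > 0" "\<And>p. p \<in> P \<Longrightarrow> z \<le> real p - 1" and M: "R ^ 4 \<le> real M"
  shows "(\<Sum>a\<in>vecs. \<Sum>b\<in>vecs. \<bar>coeff a\<bar> * \<bar>coeff b\<bar> * fejer M (\<theta> + (freq a - freq b)))
    \<le> (fejer M \<theta> + 3 / z * (3 * (real M)\<^sup>2)) / G"
proof -
  define D where "D = shift ` (vecs \<times> vecs)"
  define W where "W t = (\<Sum>ab\<in>{ab \<in> vecs \<times> vecs. shift ab = t}. \<bar>coeff (fst ab)\<bar> * \<bar>coeff (snd ab)\<bar>)" for t
  have fej: "fejer M (\<theta> + (freq a - freq b)) = fejer M (\<theta> + shift (a, b))" for a b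
    using fejer_add_of_int[of M "\<theta> + shift (a, b)" "\<lfloor>freq a - freq b\<rfloor>"] by (simp add: shift_def frac_def)
  have W0: "W 0 = 1 / G"
  proof -
    have "ab \<in> (\<lambda>a. (a, a)) ` vecs" if "ab \<in> vecs \<times> vecs" "shift ab = 0" for ab
    proof -
      have "freq (fst ab) - freq (snd ab) \<in> \<int>" using that by (simp add: shift_def)
      then have "fst ab = snd ab" using that by (intro vecs_eqI) auto
      then show ?thesis using that by (auto simp: image_iff mem_Times_iff prod_eq_iff)
    qed
    then have "{ab \<in> vecs \<times> vecs. shift ab = 0} = (\<lambda>a. (a, a)) ` vecs" by (auto simp: shift_def)
    then have "W 0 = (\<Sum>a\<in>vecs. \<bar>coeff a\<bar> * \<bar>coeff a\<bar>)"
      unfolding W_def by (simp add: sum.reindex inj_on_def)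
    then show ?thesis by (simp flip: sum_coeff_square power2_eq_square)
  qed
  have finD: "finite D" by (simp add: D_def)
  have "(\<Sum>a\<in>vecs. \<Sum>b\<in>vecs. \<bar>coeff a\<bar> * \<bar>coeff b\<bar> * fejer M (\<theta> + (freq a - freq b)))
    = (\<Sum>ab\<in>vecs \<times> vecs. \<bar>coeff (fst ab)\<bar> * \<bar>coeff (snd ab)\<bar> * fejer M (\<theta> + shift ab))"
    unfolding fej by (simp add: sum.cartesian_product split_beta)
  also have "\<dots> = (\<Sum>t\<in>D. \<Sum>ab\<in>{ab \<in> vecs \<times> vecs. shift ab = t}. \<bar>coeff (fst ab)\<bar> * \<bar>coeff (snd ab)\<bar> * fejer M (\<theta> + shift ab))"
    unfolding D_def by (rule sum.image_gen) simp
  also have "\<dots> = (\<Sum>t\<in>D. W t * fejer M (\<theta> + t))"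
    by (intro sum.cong refl) (auto simp: W_def sum_distrib_right intro!: sum.cong)
  also have "\<dots> \<le> (\<Sum>t\<in>D. (if t = 0 then fejer M \<theta> / G else 0) + 3 / (z * G) * fejer M (\<theta> + t))"
  proof (intro sum_mono)
    fix t
    show "W t * fejer M (\<theta> + t) \<le> (if t = 0 then fejer M \<theta> / G else 0) + 3 / (z * G) * fejer M (\<theta> + t)"
    proof (cases "t = 0")
      case True
      then show ?thesis using z(1) G_ge_1 by (simp add: W0)
    next
      case False
      have "W t \<le> 3 / (z * G)" unfolding W_def by (rule sum_pairs_shift_le[OF z False])
      from mult_right_mono[OF this fejer_nonneg[of M "\<theta> + t"]] show ?thesis using False by simp
    qed
  qed
  also have "\<dots> \<le> fejer M \<theta> / G + 3 / (z * G) * (\<Sum>t\<in>D. fejer M (\<theta> + t))"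
    using finD G_ge_1 by (simp add: sum.distrib sum_distrib_left sum.delta)
  also have "\<dots> \<le> fejer M \<theta> / G + 3 / (z * G) * (3 * (real M)\<^sup>2)"
  proof (intro add_left_mono mult_left_mono sum_fejer_le[OF finD, of "1 / R ^ 4"])
    show "0 \<le> 3 / (z * G)" using z(1) G_ge_1 by simp
    show "1 / R ^ 4 > 0" "real M * (1 / R ^ 4) \<ge> 1" using R_ge M by (auto simp: field_simps)
    show "1 / R ^ 4 \<le> dist_int (s - t)" if "s \<in> D" "t \<in> D" "s \<noteq> t" for s t
      using that unfolding D_def by (auto intro!: shift_spaced)
  qed
  also have "\<dots> = (fejer M \<theta> + 3 / z * (3 * (real M)\<^sup>2)) / G" by (simp add: add_divide_distrib)
  finally show ?thesis .
qed

text \<open>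
  For \<open>n \<in> A\<close> multiplication by \<open>1 = \<Sum> coeff a \<cdot> e(n freq a)\<close> turns the sum over \<open>X\<close> into one over
  \<open>X \<times> vecs\<close>; then \<open>A\<close> may be enlarged to all integers up to \<open>N\<close>. In each row of the resulting
  form, the diagonal shift contributes as in the large sieve, and the \<open>card X\<close> entries share
  the small factor \<open>3 / z\<close> for all other shifts.
\<close>

lemma sieve_dual_bound:
  fixes \<rho> :: "'x \<Rightarrow> real" and b :: "'x \<Rightarrow> complex"
  assumes z: "z > 0" "\<And>p. p \<in> P \<Longrightarrow> z \<le> real p - 1"
    and M: "R ^ 4 \<le> real M" "N \<le> M" "M > 0" "\<delta> > 0" "real M * \<delta> \<ge> 1"
    and X: "finite X" "\<And>x x'. x \<in> X \<Longrightarrow> x' \<in> X \<Longrightarrow> x \<noteq> x' \<Longrightarrow> dist_int (\<rho> x - \<rho> x') \<ge> \<delta>"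
    and A: "A \<subseteq> {1..N}" "\<And>n p. n \<in> A \<Longrightarrow> p \<in> P \<Longrightarrow> \<not> p dvd n"
  shows "(\<Sum>n\<in>A. (cmod (\<Sum>x\<in>X. b x * ee (real n * \<rho> x)))\<^sup>2)
    \<le> 6 * real M / G * (1 + 3 * real (card X) / z) * (\<Sum>x\<in>X. (cmod (b x))\<^sup>2)"
proof -
  define c where "c = (\<lambda>(x, a). b x * of_real (coeff a))"
  define \<xi> where "\<xi> = (\<lambda>(x, a). \<rho> x + freq a)"
  define E where "E \<theta> = (\<Sum>a\<in>vecs. \<Sum>b\<in>vecs. \<bar>coeff a\<bar> * \<bar>coeff b\<bar> * fejer M (\<theta> + (freq a - freq b)))" for \<theta>
  have Enn: "E \<theta> \<ge> 0" for \<theta> by (simp add: E_def sum_nonneg)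
  have Esym: "E (- \<theta>) = E \<theta>" for \<theta>
  proof -
    have "fejer M (- \<theta> + (freq a - freq b)) = fejer M (\<theta> + (freq b - freq a))" for a b
      using fejer_minus[of M "\<theta> + (freq b - freq a)"] by (simp add: algebra_simps)
    then have "E (- \<theta>) = (\<Sum>a\<in>vecs. \<Sum>b\<in>vecs. \<bar>coeff b\<bar> * \<bar>coeff a\<bar> * fejer M (\<theta> + (freq b - freq a)))"
      by (simp add: E_def mult.commute)
    then show ?thesis by (subst (asm) sum.swap) (simp add: E_def)
  qed
  have "(\<Sum>n\<in>A. (cmod (\<Sum>x\<in>X. b x * ee (real n * \<rho> x)))\<^sup>2)
      = (\<Sum>n\<in>A. (cmod (\<Sum>i\<in>X \<times> vecs. c i * ee (real n * \<xi> i)))\<^sup>2)"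
  proof (intro sum.cong refl)
    fix n assume n: "n \<in> A"
    have "(\<Sum>i\<in>X \<times> vecs. c i * ee (real n * \<xi> i)) =
      (\<Sum>x\<in>X. \<Sum>a\<in>vecs. b x * ee (real n * \<rho> x) * (of_real (coeff a) * ee (real n * freq a)))"
      by (simp add: c_def \<xi>_def sum.cartesian_product split_beta distrib_left ee_add mult_ac)
    also have "\<dots> = (\<Sum>x\<in>X. b x * ee (real n * \<rho> x) * (\<Sum>a\<in>vecs. of_real (coeff a) * ee (real n * freq a)))"
      by (simp only: sum_distrib_left)
    also have "\<dots> = (\<Sum>x\<in>X. b x * ee (real n * \<rho> x))"
      using A(2)[OF n] by (simp add: sum_coeff_ee)
    finally show "(cmod (\<Sum>x\<in>X. b x * ee (real n * \<rho> x)))\<^sup>2 = (cmod (\<Sum>i\<in>X \<times> vecs. c i * ee (real n * \<xi> i)))\<^sup>2"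
      by simp
  qed
  also have "\<dots> \<le> (\<Sum>n\<in>{1..N}. (cmod (\<Sum>i\<in>X \<times> vecs. c i * ee (real n * \<xi> i)))\<^sup>2)"
    using A(1) by (intro sum_mono2) auto
  also have "\<dots> \<le> 2 / real M * (\<Sum>i\<in>X \<times> vecs. \<Sum>j\<in>X \<times> vecs. cmod (c i) * cmod (c j) * fejer M (\<xi> i - \<xi> j))"
    using X M by (intro sum_norm_power2_le_fejer) auto
  finally have le: "(\<Sum>n\<in>A. (cmod (\<Sum>x\<in>X. b x * ee (real n * \<rho> x)))\<^sup>2)
     \<le> 2 / real M * (\<Sum>i\<in>X \<times> vecs. \<Sum>j\<in>X \<times> vecs. cmod (c i) * cmod (c j) * fejer M (\<xi> i - \<xi> j))" .
  have "(\<Sum>i\<in>X \<times> vecs. \<Sum>j\<in>X \<times> vecs. cmod (c i) * cmod (c j) * fejer M (\<xi> i - \<xi> j))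
     = (\<Sum>x\<in>X. \<Sum>x'\<in>X. cmod (b x) * cmod (b x') * E (\<rho> x - \<rho> x'))"
  proof -
    have "(\<Sum>i\<in>X \<times> vecs. \<Sum>j\<in>X \<times> vecs. cmod (c i) * cmod (c j) * fejer M (\<xi> i - \<xi> j))
      = (\<Sum>x\<in>X. \<Sum>a\<in>vecs. \<Sum>x'\<in>X. \<Sum>a'\<in>vecs. cmod (b x) * cmod (b x') * (\<bar>coeff a\<bar> * \<bar>coeff a'\<bar> *
         fejer M (\<rho> x - \<rho> x' + (freq a - freq a'))))"
      unfolding sum.cartesian_product' c_def \<xi>_def prod.case
    proof (intro sum.cong refl)
      fix x a x' a'
      have "\<rho> x + freq a - (\<rho> x' + freq a') = \<rho> x - \<rho> x' + (freq a - freq a')" by simp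
      then show "cmod (b x * of_real (coeff a)) * cmod (b x' * of_real (coeff a')) * fejer M (\<rho> x + freq a - (\<rho> x' + freq a'))
        = cmod (b x) * cmod (b x') * (\<bar>coeff a\<bar> * \<bar>coeff a'\<bar> * fejer M (\<rho> x - \<rho> x' + (freq a - freq a')))"
        by (simp only: norm_mult norm_of_real mult_ac)
    qed
    also have "\<dots> = (\<Sum>x\<in>X. \<Sum>x'\<in>X. \<Sum>a\<in>vecs. \<Sum>a'\<in>vecs. cmod (b x) * cmod (b x') * (\<bar>coeff a\<bar> * \<bar>coeff a'\<bar> *
         fejer M (\<rho> x - \<rho> x' + (freq a - freq a'))))"
      by (intro sum.cong refl sum.swap)
    finally show ?thesis by (simp only: E_def sum_distrib_left)
  qed
  also have "\<dots> \<le> (3 * (real M)\<^sup>2 * (1 + 3 * real (card X) / z) / G) * (\<Sum>x\<in>X. (cmod (b x))\<^sup>2)"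
  proof (rule quadratic_form_le)
    show "E (\<rho> x - \<rho> x') = E (\<rho> x' - \<rho> x)" for x x' using Esym[of "\<rho> x - \<rho> x'"] by simp
    show "E (\<rho> x - \<rho> x') \<ge> 0" for x x' by (rule Enn)
    fix x assume x: "x \<in> X"
    have "(\<Sum>x'\<in>X. E (\<rho> x - \<rho> x')) = (\<Sum>x'\<in>X. E (- \<rho> x + \<rho> x'))"
    proof (intro sum.cong refl)
      fix x' show "E (\<rho> x - \<rho> x') = E (- \<rho> x + \<rho> x')" using Esym[of "\<rho> x - \<rho> x'"] by simp
    qed
    also have "\<dots> \<le> (\<Sum>x'\<in>X. (fejer M (- \<rho> x + \<rho> x') + 3 / z * (3 * (real M)\<^sup>2)) / G)"
      unfolding E_def by (intro sum_mono sieve_kernel_le z M)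
    also have "\<dots> = ((\<Sum>x'\<in>X. fejer M (- \<rho> x + \<rho> x')) + real (card X) * (3 / z * (3 * (real M)\<^sup>2))) / G"
      by (simp add: sum.distrib flip: sum_divide_distrib)
    also have "\<dots> \<le> (3 * (real M)\<^sup>2 + real (card X) * (3 / z * (3 * (real M)\<^sup>2))) / G"
      using G_ge_1 X M by (intro divide_right_mono add_mono sum_fejer_le[of X \<delta>]) auto
    also have "\<dots> = 3 * (real M)\<^sup>2 * (1 + 3 * real (card X) / z) / G" by (simp add: algebra_simps)
    finally show "(\<Sum>x'\<in>X. E (\<rho> x - \<rho> x')) \<le> 3 * (real M)\<^sup>2 * (1 + 3 * real (card X) / z) / G" .
  qed
  finally have "2 / real M * (\<Sum>i\<in>X \<times> vecs. \<Sum>j\<in>X \<times> vecs. cmod (c i) * cmod (c j) * fejer M (\<xi> i - \<xi> j))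
    \<le> 2 / real M * ((3 * (real M)\<^sup>2 * (1 + 3 * real (card X) / z) / G) * (\<Sum>x\<in>X. (cmod (b x))\<^sup>2))"
    by (rule mult_left_mono) simp
  also have "\<dots> = 6 * real M / G * (1 + 3 * real (card X) / z) * (\<Sum>x\<in>X. (cmod (b x))\<^sup>2)"
    using M(3) by (simp add: power2_eq_square)
  finally show ?thesis using le by (rule order_trans[rotated])
qed

end

section \<open>The normalising sum of the sieve\<close>

lemma sum_geometric_le:
  assumes "x \<ge> (2::real)"
  shows "(\<Sum>k\<in>{1..L}. 1 / x ^ k) \<le> 1 / (x - 1)"
proof -
  have "(x - 1) * (\<Sum>k\<in>{1..L}. 1 / x ^ k) = 1 - 1 / x ^ L"
  proof (induction L)
    case (Suc L)
    have "(x - 1) * (1 / x ^ Suc L) = 1 / x ^ L - 1 / x ^ Suc L"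
      using assms by (simp add: field_simps)
    with Suc show ?case by (simp add: distrib_left del: power_Suc)
  qed auto
  then have "(\<Sum>k\<in>{1..L}. 1 / x ^ k) = (1 - 1 / x ^ L) / (x - 1)"
    using assms by (simp add: field_simps)
  also have "\<dots> \<le> 1 / (x - 1)" using assms by (intro divide_right_mono) auto
  finally show ?thesis .
qed

text \<open>
  An upper bound by part of the Euler product
  \<open>\<Prod> (1/p + 1/p\<^sup>2 + \<dots>) = \<Prod> 1 / (p - 1)\<close>. It turns reciprocals of integers with radical \<open>q\<close>
  into the term \<open>1/\<phi>(q)\<close> of the normalising sum.
\<close>

lemma sum_inverse_same_radical_le:
  assumes "finite S" "\<And>p. p \<in> S \<Longrightarrow> prime p" "finite A"
    and "\<And>n. n \<in> A \<Longrightarrow> n \<ge> 1 \<and> prime_factors n = S"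
  shows "(\<Sum>n\<in>A. 1 / real n) \<le> (\<Prod>p\<in>S. 1 / (real p - 1))"
  using assms
proof (induction S arbitrary: A)
  case empty
  then have "A \<subseteq> {1}" by (auto simp: prime_factorization_empty_iff)
  then have "(\<Sum>n\<in>A. 1 / real n) \<le> (\<Sum>n\<in>{1::nat}. 1 / real n)" by (intro sum_mono2) auto
  then show ?case by simp
next
  case (insert p S)
  have p: "prime p" and p2: "real p \<ge> 2" using insert.prems(1)[of p] prime_ge_2_nat by auto
  define m where "m n = n div p ^ multiplicity p n" for n
  define L where "L = Max (multiplicity p ` A)"
  have dec: "n = p ^ multiplicity p n * m n" for n
    by (simp add: m_def multiplicity_dvd)
  have m: "m n \<ge> 1 \<and> prime_factors (m n) = S" "multiplicity p n \<in> {1..L}" if "n \<in> A" for n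
  proof -
    have n: "n \<ge> 1" "prime_factors n = insert p S" using insert.prems(3)[OF that] by auto
    from n(2) have mult: "multiplicity p n \<ge> 1"
      by (auto simp: prime_factors_multiplicity Suc_le_eq)
    show "multiplicity p n \<in> {1..L}" using mult that insert.prems(2) by (simp add: L_def)
    have m1: "m n \<ge> 1" using dec[of n] n(1) by (cases "m n") auto
    have "\<not> p dvd m n"
      using n p unfolding m_def by (intro multiplicity_decompose) auto
    then have p_notin: "p \<notin> prime_factors (m n)" using in_prime_factors_imp_dvd by blast
    have "prime_factors n = insert p (prime_factors (m n))"
    proof -
      have "q dvd n \<longleftrightarrow> q = p \<or> q dvd m n" if "prime q" for q
      proof -
        have "q dvd n \<longleftrightarrow> q dvd p ^ multiplicity p n * m n"
          using dec[of n] by (rule arg_cong)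
        also have "\<dots> \<longleftrightarrow> q dvd p \<or> q dvd m n"
          using that mult by (simp add: prime_dvd_mult_iff prime_dvd_power_iff)
        also have "q dvd p \<longleftrightarrow> q = p" using that p by (auto dest: primes_dvd_imp_eq)
        finally show ?thesis .
      qed
      then have "{q. prime q \<and> q dvd n} = insert p {q. prime q \<and> q dvd m n}" using p by blast
      moreover have "prime_factors n = {q. prime q \<and> q dvd n}"
        "prime_factors (m n) = {q. prime q \<and> q dvd m n}"
        using n(1) m1 by (intro prime_factors_dvd; simp)+
      ultimately show ?thesis by (simp only:)
    qed
    then have "insert p (prime_factors (m n)) = insert p S" using n(2) by (rule trans[OF sym])
    with p_notin insert.hyps(2) have "prime_factors (m n) = S" by (rule iffD1[OF insert_ident])
    with m1 show "m n \<ge> 1 \<and> prime_factors (m n) = S" by blast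
  qed
  have inj: "inj_on (\<lambda>n. (multiplicity p n, m n)) A"
  proof (rule inj_onI)
    fix a b assume ab: "(multiplicity p a, m a) = (multiplicity p b, m b)"
    have "a = p ^ multiplicity p a * m a" by (rule dec)
    also have "\<dots> = p ^ multiplicity p b * m b" using ab by simp
    also have "\<dots> = b" by (rule dec[symmetric])
    finally show "a = b" .
  qed
  have "(\<Sum>n\<in>A. 1 / real n) = (\<Sum>n\<in>A. 1 / real p ^ multiplicity p n * (1 / real (m n)))"
  proof (intro sum.cong refl)
    fix n assume "n \<in> A"
    have "real n = real (p ^ multiplicity p n * m n)" using dec[of n] by (rule arg_cong)
    then show "1 / real n = 1 / real p ^ multiplicity p n * (1 / real (m n))" by simp
  qed
  also have "\<dots> = (\<Sum>q\<in>(\<lambda>n. (multiplicity p n, m n)) ` A. 1 / real p ^ fst q * (1 / real (snd q)))"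
    by (subst sum.reindex[OF inj]) simp
  also have "\<dots> \<le> (\<Sum>q\<in>{1..L} \<times> m ` A. 1 / real p ^ fst q * (1 / real (snd q)))"
  proof (rule sum_mono2)
    show "finite ({1..L} \<times> m ` A)" using insert.prems(2) by blast
    show "(\<lambda>n. (multiplicity p n, m n)) ` A \<subseteq> {1..L} \<times> m ` A" using m(2) by blast
  qed simp
  also have "\<dots> = (\<Sum>k\<in>{1..L}. 1 / real p ^ k) * (\<Sum>l\<in>m ` A. 1 / real l)"
    by (simp add: sum_product sum.cartesian_product split_beta)
  also have "\<dots> \<le> 1 / (real p - 1) * (\<Prod>p\<in>S. 1 / (real p - 1))"
  proof (intro mult_mono sum_geometric_le p2)
    show "(\<Sum>l\<in>m ` A. 1 / real l) \<le> (\<Prod>p\<in>S. 1 / (real p - 1))"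
    proof (rule insert.IH)
      show "prime q" if "q \<in> S" for q using insert.prems(1) that by blast
      show "finite (m ` A)" using insert.prems(2) by blast
      show "l \<ge> 1 \<and> prime_factors l = S" if "l \<in> m ` A" for l using m(1) that by blast
    qed
  qed (use p2 in \<open>auto intro!: sum_nonneg\<close>)
  also have "\<dots> = (\<Prod>p\<in>insert p S. 1 / (real p - 1))" using insert.hyps by simp
  finally show ?case .
qed

lemma smooth_rough_decomposition:
  assumes "n \<ge> (1::nat)"
  obtains s r where "n = s * r" "\<And>p. p \<in> prime_factors s \<Longrightarrow> p \<le> z" "\<And>p. p \<in> prime_factors r \<Longrightarrow> z < p"
proof
  define F where "F = prime_factorization n"
  have primes: "prime p" if "p \<in># F" for p using that by (auto simp: F_def in_prime_factors_iff)
  have "prod_mset F = n" using assms by (simp add: F_def)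
  moreover have "F = filter_mset (\<lambda>p. p \<le> z) F + filter_mset (\<lambda>p. \<not> p \<le> z) F"
    by (rule multiset_partition)
  ultimately show "n = prod_mset (filter_mset (\<lambda>p. p \<le> z) F) * prod_mset (filter_mset (\<lambda>p. \<not> p \<le> z) F)"
    using prod_mset_Un[of "filter_mset (\<lambda>p. p \<le> z) F" "filter_mset (\<lambda>p. \<not> p \<le> z) F"] by (simp only:)
  show "p \<le> z" if "p \<in> prime_factors (prod_mset (filter_mset (\<lambda>p. p \<le> z) F))" for p
    using that primes by (subst (asm) prime_factorization_prod_mset_primes) auto
  show "z < p" if "p \<in> prime_factors (prod_mset (filter_mset (\<lambda>p. \<not> p \<le> z) F))" for p
    using that primes by (subst (asm) prime_factorization_prod_mset_primes) auto
qed

text \<open>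
  Factoring every \<open>n \<le> R\<close> into a \<open>z\<close>-smooth and a \<open>z\<close>-rough part bounds \<open>\<Sum> 1/n\<close> by the product of
  the two reciprocal sums. The rough one is at most \<open>G\<close> after grouping by radicals.
\<close>

lemma sieve_G_ge:
  assumes z: "z \<ge> 1" and R: "R \<ge> 1" and T: "T = ln (real z) + ln 4 + 2"
  defines "P \<equiv> {p. prime p \<and> z < p \<and> real p \<le> R}"
  shows "ln R \<le> (2 + 4 * T) * sieve.G P R"
proof -
  have finP: "finite P"
    by (rule finite_subset[of _ "{..nat \<lfloor>R\<rfloor>}"]) (auto simp: P_def intro: le_nat_floor)
  interpret sieve P R by standard (use finP R in \<open>auto simp: P_def\<close>)
  define Y where "Y = nat \<lfloor>R\<rfloor>"
  define A where "A = {n. 1 \<le> n \<and> n \<le> Y \<and> (\<forall>p\<in>prime_factors n. p \<le> z)}"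
  define B where "B = {n. 1 \<le> n \<and> n \<le> Y \<and> (\<forall>p\<in>prime_factors n. z < p)}"
  have fin: "finite A" "finite B"
    by (rule finite_subset[of _ "{..Y}"], auto simp: A_def B_def)+
  have YR: "n \<le> Y \<longleftrightarrow> real n \<le> R" for n
    unfolding Y_def using R by (subst le_nat_iff) (auto simp: le_floor_iff)
  have "\<forall>n\<in>{1..Y}. \<exists>sr. sr \<in> A \<times> B \<and> n = fst sr * snd sr"
  proof
    fix n assume n: "n \<in> {1..Y}"
    then obtain s r where sr: "n = s * r" "\<And>p. p \<in> prime_factors s \<Longrightarrow> p \<le> z" "\<And>p. p \<in> prime_factors r \<Longrightarrow> z < p"
      using smooth_rough_decomposition[of n z] by auto
    then have "s \<ge> 1" "r \<ge> 1" using n by (auto simp: Suc_le_eq)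
    moreover from this have "s \<le> n" "r \<le> n" using sr(1) by auto
    then have "s \<le> Y" "r \<le> Y" using n by auto
    ultimately have "(s, r) \<in> A \<times> B" using n sr by (auto simp: A_def B_def)
    then show "\<exists>sr. sr \<in> A \<times> B \<and> n = fst sr * snd sr" using sr(1) by (intro exI[of _ "(s, r)"]) auto
  qed
  then obtain g where g: "\<And>n. n \<in> {1..Y} \<Longrightarrow> g n \<in> A \<times> B \<and> n = fst (g n) * snd (g n)" by metis
  have inj: "inj_on g {1..Y}"
  proof (rule inj_onI)
    fix m n assume "m \<in> {1..Y}" "n \<in> {1..Y}" "g m = g n"
    then show "m = n" using conjunct2[OF g[of m]] conjunct2[OF g[of n]] by (metis (no_types))
  qed
  have "R \<le> real Y + 1" unfolding Y_def using R by linarith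
  then have "ln R \<le> ln (real Y + 1)" using R by simp
  also have "\<dots> \<le> harm Y" by (rule ln_le_harm)
  also have "\<dots> = (\<Sum>n\<in>{1..Y}. 1 / real (fst (g n)) * (1 / real (snd (g n))))"
    unfolding harm_def
  proof (intro sum.cong refl)
    fix n assume "n \<in> {1..Y}"
    from conjunct2[OF g[OF this]] have "real n = real (fst (g n) * snd (g n))" by (rule arg_cong)
    then show "inverse (real n) = 1 / real (fst (g n)) * (1 / real (snd (g n)))"
      by (simp add: divide_inverse)
  qed
  also have "\<dots> = (\<Sum>q\<in>g ` {1..Y}. 1 / real (fst q) * (1 / real (snd q)))"
    by (subst sum.reindex[OF inj]) simp
  also have "\<dots> \<le> (\<Sum>q\<in>A \<times> B. 1 / real (fst q) * (1 / real (snd q)))"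
  proof (rule sum_mono2)
    show "finite (A \<times> B)" using fin by blast
    show "g ` {1..Y} \<subseteq> A \<times> B"
    proof (rule image_subsetI)
      fix n assume "n \<in> {1..Y}"
      from g[OF this] show "g n \<in> A \<times> B" by (rule conjunct1)
    qed
  qed simp
  also have "\<dots> = (\<Sum>s\<in>A. 1 / real s) * (\<Sum>r\<in>B. 1 / real r)"
    by (simp add: sum_product sum.cartesian_product split_beta)
  also have "\<dots> \<le> (2 + 4 * T) * G"
  proof (rule mult_mono)
    show "(\<Sum>s\<in>A. 1 / real s) \<le> 2 + 4 * T"
      unfolding A_def by (rule sum_inverse_smooth_le[OF z T])
    have im: "prime_factors ` B \<subseteq> supports"
    proof
      fix S assume "S \<in> prime_factors ` B"
      then obtain r where r: "S = prime_factors r" "1 \<le> r" "r \<le> Y" "\<forall>p\<in>prime_factors r. z < p"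
        by (auto simp: B_def)
      have "\<Prod>S dvd r" using r by (intro prod_primes_dvd) (auto simp: in_prime_factors_iff)
      then have "\<Prod>S \<le> r" using r(2) by (intro dvd_imp_le) auto
      also note r(3)
      finally have "real (\<Prod>S) \<le> R" by (simp only: YR)
      moreover have "p \<in> P" if "p \<in> S" for p
      proof -
        have "p \<le> r" using that r(1,2) by (auto simp: in_prime_factors_iff intro: dvd_imp_le)
        also note r(3)
        finally have "real p \<le> R" by (simp only: YR)
        then show ?thesis using that r by (auto simp: P_def in_prime_factors_iff)
      qed
      ultimately show "S \<in> supports" unfolding supports_def by blast
    qed
    have "(\<Sum>r\<in>B. 1 / real r) = (\<Sum>S\<in>prime_factors ` B. \<Sum>r\<in>{r \<in> B. prime_factors r = S}. 1 / real r)"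
      by (rule sum.image_gen[OF fin(2)])
    also have "\<dots> \<le> (\<Sum>S\<in>prime_factors ` B. \<Prod>p\<in>S. 1 / (real p - 1))"
    proof (intro sum_mono sum_inverse_same_radical_le)
      fix S assume "S \<in> prime_factors ` B"
      then have "S \<subseteq> P" using im by (auto simp: supports_def)
      then show "finite S" "\<And>p. p \<in> S \<Longrightarrow> prime p" using finP prime_P finite_subset by blast+
      show "finite {r \<in> B. prime_factors r = S}" using fin(2) by simp
      show "r \<ge> 1 \<and> prime_factors r = S" if "r \<in> {r \<in> B. prime_factors r = S}" for r
        using that by (simp add: B_def)
    qed
    also have "\<dots> \<le> G"
      unfolding G_def
    proof (rule sum_mono2[OF finite_supports im])
      fix S assume "S \<in> supports - prime_factors ` B"
      then have "real p - 1 \<ge> 0" if "p \<in> S" for p using that P_ge_2[of p] by (auto simp: supports_def)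
      then show "0 \<le> (\<Prod>p\<in>S. 1 / (real p - 1))" by (intro prod_nonneg) simp
    qed
    finally show "(\<Sum>r\<in>B. 1 / real r) \<le> G" .
    show "0 \<le> 2 + 4 * T" using z by (simp add: T)
  qed (simp add: sum_nonneg)
  finally show ?thesis .
qed

section \<open>The dual inequality for primes\<close>

lemma ln_le_sqrt:
  assumes "x \<ge> 1"
  shows "ln x \<le> sqrt x"
proof -
  have "ln x \<le> sqrt (x - 1)" using ln_one_plus_square_le[of "sqrt (x - 1)"] assms by simp
  also have "\<dots> \<le> sqrt x" by simp
  finally show ?thesis .
qed

text \<open>
  At most \<open>\<surd>N\<close> primes are below \<open>\<surd>N\<close>, and the others have \<open>log p \<ge> (log N) / 2\<close>.
\<close>

lemma card_primes_le:
  assumes N: "N \<ge> 1"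
  shows "real (card {p. prime p \<and> real p \<le> N}) * ln N \<le> 4 * N"
proof -
  define A where "A = {p. prime p \<and> real p \<le> sqrt N}"
  define B where "B = {p. prime p \<and> sqrt N < real p \<and> real p \<le> N}"
  have NN: "p \<le> nat \<lfloor>x\<rfloor>" if "real p \<le> x" for p x using that by (rule le_nat_floor)
  have "B \<subseteq> {..nat \<lfloor>N\<rfloor>}" using NN by (auto simp: B_def)
  then have finB: "finite B" by (rule finite_subset) simp
  have "A \<subseteq> {1..nat \<lfloor>sqrt N\<rfloor>}" using NN by (auto simp: A_def dest: prime_ge_1_nat)
  then have "card A \<le> nat \<lfloor>sqrt N\<rfloor>" "finite A"
    using card_mono[of "{1..nat \<lfloor>sqrt N\<rfloor>}" A] finite_subset[of A "{1..nat \<lfloor>sqrt N\<rfloor>}"] by auto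
  then have "real (card A) \<le> sqrt N" using N by (simp add: le_nat_iff le_floor_iff)
  then have "real (card A) * ln N \<le> sqrt N * sqrt N"
    using N by (intro mult_mono ln_le_sqrt) auto
  then have cA: "real (card A) * ln N \<le> N" using N by simp
  have "real (card B) * (ln N / 2) = (\<Sum>p\<in>B. ln N / 2)" by simp
  also have "\<dots> \<le> (\<Sum>p\<in>B. ln (real p))"
  proof (rule sum_mono)
    fix p assume "p \<in> B"
    then have "ln (sqrt N) \<le> ln (real p)" using N by (simp add: B_def prime_gt_0_nat)
    then show "ln N / 2 \<le> ln (real p)" using N by (simp add: ln_sqrt)
  qed
  also have "\<dots> \<le> (\<Sum>p | prime p \<and> p \<le> nat \<lfloor>N\<rfloor>. ln (real p))"
  proof (rule sum_mono2)
    show "finite {p. prime p \<and> p \<le> nat \<lfloor>N\<rfloor>}" by (rule finite_subset[of _ "{..nat \<lfloor>N\<rfloor>}"]) auto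
    show "B \<subseteq> {p. prime p \<and> p \<le> nat \<lfloor>N\<rfloor>}" using NN by (auto simp: B_def)
    show "0 \<le> ln (real p)" if "p \<in> {p. prime p \<and> p \<le> nat \<lfloor>N\<rfloor>} - B" for p
      using that prime_ge_1_nat[of p] by simp
  qed
  also have "\<dots> \<le> real (nat \<lfloor>N\<rfloor>) * ln 4" by (rule sum_ln_primes_le)
  also have "\<dots> \<le> N * (3 / 2)"
  proof (rule mult_mono)
    have "ln (4::real) = 2 * ln 2" using ln_realpow[of 2 2] by simp
    then show "ln 4 \<le> (3 / 2 :: real)" using ln2_le_25_over_36 by simp
  qed (use N in auto)
  finally have cB: "real (card B) * ln N \<le> 3 * N" by simp
  have "{p. prime p \<and> real p \<le> N} \<subseteq> A \<union> B" by (auto simp: A_def B_def)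
  then have "card {p. prime p \<and> real p \<le> N} \<le> card (A \<union> B)"
    using finB \<open>finite A\<close> by (intro card_mono) auto
  also have "\<dots> \<le> card A + card B" by (rule card_Un_le)
  finally have "real (card {p. prime p \<and> real p \<le> N}) * ln N \<le> real (card A + card B) * ln N"
    using N by (intro mult_right_mono) auto
  also have "\<dots> \<le> 4 * N" using cA cB by (simp add: algebra_simps)
  finally show ?thesis .
qed

lemma trivial_dual_bound:
  fixes \<rho> :: "'x \<Rightarrow> real" and b :: "'x \<Rightarrow> complex"
  shows "(\<Sum>n\<in>A. (cmod (\<Sum>x\<in>X. b x * ee (real n * \<rho> x)))\<^sup>2)
    \<le> real (card X) * real (card A) * (\<Sum>x\<in>X. (cmod (b x))\<^sup>2)"
proof -
  have "(cmod (\<Sum>x\<in>X. b x * ee (real n * \<rho> x)))\<^sup>2 \<le> real (card X) * (\<Sum>x\<in>X. (cmod (b x))\<^sup>2)" for n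
  proof -
    have "cmod (\<Sum>x\<in>X. b x * ee (real n * \<rho> x)) \<le> (\<Sum>x\<in>X. 1 * cmod (b x))"
      by (rule order_trans[OF norm_sum]) (simp add: norm_mult)
    then have "(cmod (\<Sum>x\<in>X. b x * ee (real n * \<rho> x)))\<^sup>2 \<le> (\<Sum>x\<in>X. 1 * cmod (b x))\<^sup>2"
      by (intro power_mono) auto
    also have "\<dots> \<le> (\<Sum>x\<in>X. 1\<^sup>2) * (\<Sum>x\<in>X. (cmod (b x))\<^sup>2)" by (rule Cauchy_Schwarz_ineq_sum)
    finally show ?thesis by simp
  qed
  then have "(\<Sum>n\<in>A. (cmod (\<Sum>x\<in>X. b x * ee (real n * \<rho> x)))\<^sup>2)
    \<le> (\<Sum>n\<in>A. real (card X) * (\<Sum>x\<in>X. (cmod (b x))\<^sup>2))" by (intro sum_mono)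
  then show ?thesis by (simp add: mult_ac)
qed

lemma large_sieve_dual_bound:
  fixes \<rho> :: "'x \<Rightarrow> real" and b :: "'x \<Rightarrow> complex"
  assumes M: "N \<le> M" "M > 0" "\<delta> > 0" "real M * \<delta> \<ge> 1"
    and X: "finite X" "\<And>x x'. x \<in> X \<Longrightarrow> x' \<in> X \<Longrightarrow> x \<noteq> x' \<Longrightarrow> dist_int (\<rho> x - \<rho> x') \<ge> \<delta>"
  shows "(\<Sum>n\<in>{1..N}. (cmod (\<Sum>x\<in>X. b x * ee (real n * \<rho> x)))\<^sup>2)
    \<le> 6 * real M * (\<Sum>x\<in>X. (cmod (b x))\<^sup>2)"
proof -
  have "(\<Sum>n\<in>{1..N}. (cmod (\<Sum>x\<in>X. b x * ee (real n * \<rho> x)))\<^sup>2)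
    \<le> 2 / real M * (\<Sum>x\<in>X. \<Sum>x'\<in>X. cmod (b x) * cmod (b x') * fejer M (\<rho> x - \<rho> x'))"
    using X M by (intro sum_norm_power2_le_fejer) auto
  also have "\<dots> \<le> 2 / real M * ((3 * (real M)\<^sup>2) * (\<Sum>x\<in>X. (cmod (b x))\<^sup>2))"
  proof (intro mult_left_mono quadratic_form_le)
    show "fejer M (\<rho> x - \<rho> x') = fejer M (\<rho> x' - \<rho> x)" for x x'
      using fejer_minus[of M "\<rho> x - \<rho> x'"] by simp
    then show "(\<Sum>x'\<in>X. fejer M (\<rho> x - \<rho> x')) \<le> 3 * (real M)\<^sup>2" for x
      using sum_fejer_le[OF X(1) M(3,4), of \<rho> "- \<rho> x"] X(2) by simp
  qed auto
  also have "\<dots> = 6 * real M * (\<Sum>x\<in>X. (cmod (b x))\<^sup>2)" using M(2) by (simp add: power2_eq_square)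
  finally show ?thesis .
qed

text \<open>
  The threshold \<open>46\<close> is just below \<open>280\<close> over the constant of the large sieve, which is slightly above \<open>6\<close> because
  \<open>M\<close> is \<open>W\<close> rounded up. The threshold \<open>256\<close> keeps \<open>4 K\<close> below \<open>280 L\<close> in the first range and makes
  \<open>L \<ge> 6\<close> in the last one, where the sieve gives \<open>125 L + 751\<close> in place of \<open>280 L\<close>.
\<close>

lemma primes_dual_bound:
  fixes \<rho> :: "'x \<Rightarrow> real" and b :: "'x \<Rightarrow> complex"
  assumes N: "N \<ge> 1000" and \<delta>: "\<delta> > 0"
    and X: "finite X" "X \<noteq> {}" "\<And>x x'. x \<in> X \<Longrightarrow> x' \<in> X \<Longrightarrow> x \<noteq> x' \<Longrightarrow> dist_int (\<rho> x - \<rho> x') \<ge> \<delta>"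
  shows "(\<Sum>p | prime p \<and> real p \<le> N. (cmod (\<Sum>x\<in>X. b x * ee (real p * \<rho> x)))\<^sup>2)
    \<le> 280 * ((N + inverse \<delta>) / ln N) * ln (2 * real (card X)) * (\<Sum>x\<in>X. (cmod (b x))\<^sup>2)"
proof -
  define K where "K = card X"
  define L where "L = ln (2 * real K)"
  define W where "W = N + inverse \<delta>"
  define S where "S = (\<Sum>x\<in>X. (cmod (b x))\<^sup>2)"
  define F where "F n = (cmod (\<Sum>x\<in>X. b x * ee (real n * \<rho> x)))\<^sup>2" for n :: nat
  define P where "P = {p. prime p \<and> real p \<le> N}"
  define M where "M = nat \<lceil>W\<rceil>"
  have K1: "K \<ge> 1" using X by (simp add: K_def Suc_le_eq card_gt_0_iff)
  have S0: "S \<ge> 0" by (simp add: S_def sum_nonneg)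
  have WN: "W \<ge> N" "W \<ge> inverse \<delta>" "W > 0" using N \<delta> by (auto simp: W_def add_nonneg_pos)
  have lnN: "ln N > 0" using N by simp
  have ln2: "ln (2::real) \<ge> 2 / 3" "ln (2::real) \<le> 25 / 36"
    using ln2_ge_two_thirds ln2_le_25_over_36 by auto
  have PN: "P \<subseteq> {1..nat \<lfloor>N\<rfloor>}"
  proof
    fix p assume "p \<in> P"
    then show "p \<in> {1..nat \<lfloor>N\<rfloor>}" using prime_ge_1_nat[of p] le_nat_floor[of p N] by (simp add: P_def)
  qed
  have M: "real M \<le> W + 1" "real M \<ge> W" "nat \<lfloor>N\<rfloor> \<le> M" "M > 0" "real M * \<delta> \<ge> 1"
  proof -
    show MW: "real M \<le> W + 1" "real M \<ge> W" using WN by (auto simp: M_def)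
    then show "M > 0" using WN by (metis of_nat_0_less_iff less_le_trans)
    have "real (nat \<lfloor>N\<rfloor>) \<le> real M" using MW WN N by linarith
    then show "nat \<lfloor>N\<rfloor> \<le> M" by simp
    have "inverse \<delta> * \<delta> \<le> real M * \<delta>" using MW WN \<delta> by (intro mult_right_mono) auto
    then show "real M * \<delta> \<ge> 1" using \<delta> by simp
  qed
  have M2: "real M \<le> 1001 / 1000 * W" using M(1) WN N by simp
  have Fnn: "F n \<ge> 0" for n by (simp add: F_def)
  have "sum F P \<le> 280 * (W / ln N) * L * S"
  proof -
    consider "K \<le> 256" | "K > 256" "ln N \<le> 46 * L" | "K > 256" "ln N > 46 * L" by linarith
    then show ?thesis
    proof cases
      case 1
      have KL: "4 * real K \<le> 280 * L"
      proof (cases "K \<le> 46")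
        case True
        have "ln 2 \<le> L" using K1 by (simp add: L_def)
        then show ?thesis using True ln2 by linarith
      next
        case False
        have "ln (64::real) = 6 * ln 2" using ln_realpow[of 2 6] by simp
        moreover have "ln 64 \<le> L" using False by (simp add: L_def)
        ultimately show ?thesis using 1 ln2 by linarith
      qed
      have "sum F P \<le> real K * real (card P) * S"
        unfolding F_def K_def S_def by (rule trivial_dual_bound)
      also have "\<dots> \<le> real K * (4 * W / ln N) * S"
      proof (intro mult_right_mono mult_left_mono S0)
        have "real (card P) * ln N \<le> 4 * N" unfolding P_def by (rule card_primes_le) (use N in simp)
        also have "\<dots> \<le> 4 * W" using WN by simp
        finally show "real (card P) \<le> 4 * W / ln N" using lnN by (simp add: field_simps)
      qed simp
      also have "\<dots> = (4 * real K) * (W / ln N * S)" by simp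
      also have "\<dots> \<le> (280 * L) * (W / ln N * S)"
        using WN lnN S0 by (intro mult_right_mono KL) auto
      finally show ?thesis by (simp add: mult_ac)
    next
      case 2
      have "sum F P \<le> sum F {1..nat \<lfloor>N\<rfloor>}" using PN Fnn by (intro sum_mono2) auto
      also have "\<dots> \<le> 6 * real M * S"
        unfolding F_def S_def by (rule large_sieve_dual_bound[OF M(3,4) \<delta> M(5) X(1,3)])
      also have "\<dots> \<le> 6 * (1001 / 1000 * W) * S" using M2 S0 by (intro mult_right_mono mult_left_mono) auto
      also have "\<dots> = (6 * (1001 / 1000) * ln N) * (W / ln N * S)" using lnN by simp
      also have "\<dots> \<le> (280 * L) * (W / ln N * S)"
        using WN lnN S0 2 by (intro mult_right_mono) auto
      finally show ?thesis by (simp add: mult_ac)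
    next
      case 3
      have L6: "L \<ge> 6"
      proof -
        have "ln (512::real) = 9 * ln 2" using ln_realpow[of 2 9] by simp
        moreover have "ln 512 \<le> L" using 3 by (simp add: L_def)
        ultimately show ?thesis using ln2 by linarith
      qed
      \<comment> \<open>The exponent keeps the shifts \<open>R\<^sup>-\<^sup>4 = 1/N\<close> apart, so that they do not enlarge \<open>M\<close>.\<close>
      define R where "R = N powr (1 / 4)"
      \<comment> \<open>The factor \<open>10\<close> makes the off-diagonal shifts cost \<open>3/10\<close> of the diagonal; a smaller one would
        increase that share, a larger one \<open>log z\<close>.\<close>
      define z where "z = 10 * K"
      define T where "T = ln (real z) + ln 4 + 2"
      define Q where "Q = {p. prime p \<and> z < p \<and> real p \<le> R}"
      define A1 where "A1 = {p \<in> P. real p \<le> R}"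
      define A2 where "A2 = {p \<in> P. R < real p}"
      have R1: "R \<ge> 1" using N by (simp add: R_def ge_one_powr_ge_zero)
      have R4: "R ^ 4 = N" using N by (simp add: R_def powr_powr flip: powr_realpow)
      have lnR: "ln R = ln N / 4" using N by (simp add: R_def)
      have finP: "finite P" using PN finite_subset by blast
      have finQ: "finite Q"
        by (rule finite_subset[of _ "{..nat \<lfloor>R\<rfloor>}"]) (auto simp: Q_def intro: le_nat_floor)
      interpret sieve Q R by standard (use finQ R1 in \<open>auto simp: Q_def\<close>)
      have lnz: "T \<le> L + 11 / 2"
      proof -
        have "ln (real z) = L + ln 5"
          using K1 ln_mult[of "2 * real K" 5] by (simp add: z_def L_def mult.commute)
        moreover have "ln (5::real) \<le> ln (2 ^ 3)" by simp
        moreover have "ln (2 ^ 3::real) = 3 * ln 2" using ln_realpow[of 2 3] by simp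
        moreover have "ln (4::real) = 2 * ln 2" using ln_realpow[of 2 2] by simp
        ultimately show ?thesis using ln2 by (simp only: T_def)
      qed
      have "ln N / 4 \<le> (2 + 4 * T) * G"
        using sieve_G_ge[of z R T] K1 R1 T_def by (simp add: z_def lnR Q_def)
      also have "\<dots> \<le> (4 * L + 24) * G" using lnz G_ge_1 by (intro mult_right_mono) auto
      finally have G: "1 / G \<le> 4 * (4 * L + 24) / ln N" using lnN G_ge_1 by (simp add: field_simps)
      have "sum F A2 \<le> 6 * real M / G * (1 + 3 * real (card X) / real z) * S"
        unfolding F_def S_def
      proof (rule sieve_dual_bound[of "real z" M "nat \<lfloor>N\<rfloor>" \<delta>])
        show "real z > 0" using K1 by (simp add: z_def)
        show "real z \<le> real p - 1" if "p \<in> Q" for p using that by (simp add: Q_def)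
        show "R ^ 4 \<le> real M" using R4 WN M by simp
        show "A2 \<subseteq> {1..nat \<lfloor>N\<rfloor>}" using PN by (auto simp: A2_def)
        show "\<not> p dvd n" if "n \<in> A2" "p \<in> Q" for n p
        proof
          assume "p dvd n"
          then have "p = n" using that by (intro primes_dvd_imp_eq) (auto simp: A2_def P_def Q_def)
          then show False using that by (auto simp: A2_def Q_def)
        qed
      qed (use M \<delta> X in auto)
      also have "1 + 3 * real (card X) / real z = 13 / 10" using K1 by (simp add: z_def K_def)
      also have "6 * real M / G * (13 / 10) * S = real M * (1 / G) * (39 / 5 * S)" by simp
      also have "\<dots> \<le> (1001 / 1000 * W) * (4 * (4 * L + 24) / ln N) * (39 / 5 * S)"
        using M2 G G_ge_1 S0 WN by (intro mult_right_mono mult_mono) auto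
      \<comment> \<open>\<open>312312 / 10000 = 1001 / 1000 * 4 * (39 / 5)\<close>\<close>
      also have "\<dots> = (312312 / 10000 * (4 * L + 24)) * (W / ln N * S)" using lnN by (simp add: field_simps)
      finally have b2: "sum F A2 \<le> (312312 / 10000 * (4 * L + 24)) * (W / ln N * S)" .
      have "sum F A1 \<le> real K * real (card A1) * S"
        unfolding F_def K_def S_def by (rule trivial_dual_bound)
      also have "\<dots> \<le> (W / ln N) * S"
      proof (rule mult_right_mono[OF _ S0])
        have "A1 \<subseteq> {1..nat \<lfloor>R\<rfloor>}" using PN le_nat_floor[of _ R] by (auto simp: A1_def)
        then have "card A1 \<le> nat \<lfloor>R\<rfloor>" using card_mono[of "{1..nat \<lfloor>R\<rfloor>}" A1] by simp
        then have cA: "real (card A1) \<le> R" using R1 by linarith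
        have "ln (real K) \<le> L" using K1 by (simp add: L_def)
        then have "ln (real K) \<le> ln R" using 3 L6 lnR by linarith
        then have "real K \<le> R" using K1 R1 by simp
        then have "real K * real (card A1) \<le> R * R" using cA R1 by (intro mult_mono) auto
        also have "R * R = sqrt N"
          using R4 R1 by (intro real_sqrt_unique[symmetric]) (simp_all add: power4_eq_xxxx power2_eq_square mult.assoc)
        finally have "real K * real (card A1) * ln N \<le> sqrt N * sqrt N"
          using ln_le_sqrt[of N] N lnN by (intro mult_mono) auto
        then have "real K * real (card A1) * ln N \<le> W" using N WN by simp
        then show "real K * real (card A1) \<le> W / ln N" using lnN by (simp add: field_simps)
      qed
      finally have b1: "sum F A1 \<le> 1 * (W / ln N * S)" by simp
      have "sum F P = sum F A1 + sum F A2"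
      proof -
        have "P = A1 \<union> A2" by (auto simp: A1_def A2_def)
        then show ?thesis using finP by (simp only:) (intro sum.union_disjoint, auto simp: A1_def A2_def)
      qed
      also have "\<dots> \<le> (1 + 312312 / 10000 * (4 * L + 24)) * (W / ln N * S)"
        using b1 b2 by (simp only: distrib_right)
      also have "\<dots> \<le> (280 * L) * (W / ln N * S)"
      proof (rule mult_right_mono)
        show "1 + 312312 / 10000 * (4 * L + 24) \<le> 280 * L" using L6 by (simp add: field_simps)
        show "0 \<le> W / ln N * S" using WN lnN S0 by simp
      qed
      finally show ?thesis by (simp add: mult_ac)
    qed
  qed
  then show ?thesis by (simp add: F_def P_def W_def L_def K_def S_def)
qed

lemma e_circle_nat_scale: "e_circle (nat_scale p x) = ee (real p * rep_circle x)"
proof -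
  have "x = abs_circle (rep_circle x)" using Quotient_abs_rep[OF Quotient_circle] by metis
  then have "e_circle (nat_scale p x) = e_circle (nat_scale p (abs_circle (rep_circle x)))" by simp
  also have "\<dots> = exp (2 * \<i> * of_real pi * of_real (real p * rep_circle x))"
    by (simp add: nat_scale.abs_eq e_circle.abs_eq)
  also have "\<dots> = ee (real p * rep_circle x)" by (simp add: ee_def cis_conv_exp mult_ac)
  finally show ?thesis .
qed

lemma circle_dist_int_diff: "circle_dist_int (x - y) = dist_int (rep_circle x - rep_circle y)"
proof -
  have "abs_circle (rep_circle w) = w" for w using Quotient_abs_rep[OF Quotient_circle] by metis
  then have "circle_dist_int (x - y) = circle_dist_int (abs_circle (rep_circle x) - abs_circle (rep_circle y))"
    by simp
  then show ?thesis by (simp add: minus_circle.abs_eq circle_dist_int.abs_eq)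
qed

theorem theorem1p1:
  fixes \<delta> N :: real and X :: "circle set" and u :: "nat \<Rightarrow> complex"
  assumes "\<delta> > 0"
    and "X \<noteq> {}"
    and "well_spaced \<delta> X"
    and "N \<ge> 1000"
  shows "(\<Sum>x\<in>X. (cmod (\<Sum>p | prime p \<and> real p \<le> N. u p * e_circle (nat_scale p x)))\<^sup>2)
    \<le> 280 * ((N + inverse \<delta>) / ln N) * ln (2 * real (card X))
        * (\<Sum>p | prime p \<and> real p \<le> N. (cmod (u p))\<^sup>2)"
proof (rule duality)
  show fin: "finite X" by (rule well_spaced_finite[OF assms(1,3)])
  show "finite {p. prime p \<and> real p \<le> N}"
    by (rule finite_subset[of _ "{..nat \<lfloor>N\<rfloor>}"]) (auto intro: le_nat_floor)
  have "card X \<ge> 1" using fin assms(2) by (simp add: Suc_le_eq card_gt_0_iff)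
  then show "0 \<le> 280 * ((N + inverse \<delta>) / ln N) * ln (2 * real (card X))"
    using assms(1,4) by (intro mult_nonneg_nonneg divide_nonneg_nonneg) auto
  show "(\<Sum>p | prime p \<and> real p \<le> N. (cmod (\<Sum>x\<in>X. b x * e_circle (nat_scale p x)))\<^sup>2)
    \<le> 280 * ((N + inverse \<delta>) / ln N) * ln (2 * real (card X)) * (\<Sum>x\<in>X. (cmod (b x))\<^sup>2)" for b
    unfolding e_circle_nat_scale
    using assms(3) by (intro primes_dual_bound assms fin) (auto simp: well_spaced_def circle_dist_int_diff)
qed

end
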